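(* Let $\lambda$ and $\mu$ be real numbers with $0<\lambda<1$ and $\mu>0$. Then the map $\delta\mapsto\rho_{\lambda,\mu,\delta}$ is a continuous non-decreasing function sending the interval $(1-\lambda,d_{\lambda,\mu})$ onto the interval $(0,r_{\lambda,\mu})$ and satisfying the following properties. (i) Let $p/q$ be a rational number with $0<p/q<r_{\lambda,\mu}$, where $p$ and $q$ are relatively prime (positive) integers. Then, for $\delta\in(1-\lambda,d_{\lambda,\mu})$, $\rho_{\lambda,\mu,\delta}=p/q$ if and only if $$\delta\left(\lambda,\mu,(p/q)^-\right)\le\delta\le\delta\left(\lambda,\mu,p/q\right),$$ with the explicit formulae $$\delta\left(\lambda,\mu,p/q\right)=\frac{(1-\lambda)\left(1+\mu S+\lambda^{q-1}\mu^p(1-\lambda)\right)}{1+(\mu-1)S+\lambda^{q-1}\mu^{p-1}(\mu-\lambda\mu-1)},$$ $$\delta\left(\lambda,\mu,(p/q)^-\right)=\frac{(1-\lambda)(1+\mu S)}{1+(\mu-1)S-\lambda^q\mu^{p-1}},$$ where $$S=S(\lambda,\mu,p/q):=\sum_{k=1}^{q-2}\left(\left\lfloor (k+1)\frac pq\right\rfloor-\left\lfloor k\frac pq\right\rfloor\right)\lambda^k\mu^{\lfloor kp/q\rfloor},$$ and the sum $S$ equals $0$ when $q=2$. (ii) For every irrational number $\rho$ with $0<\rho<r_{\lambda,\mu}$, there exists one and only one real number $\delta$ such that $1-\lambda<\delta<d_{\lambda,\mu}$ and $\rho_{\lambda,\mu,\delta}=\rho$, and it is given by $\delta=\delta(\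lambda,\mu,\rho)$.
   Context: Let $I=[0,1)$; $\lfloor x\rfloor$ is the floor and $\{x\}=x-\lfloor x\rfloor$ the fractional part of $x$. For real numbers $0<\lambda<1$, $\mu>0$ put $$d_{\lambda,\mu}=\begin{cases}1&\text{if }\lambda\mu<1,\\ \frac{\mu-\lambda\mu}{\mu-1}&\text{if }\lambda\mu\ge1,\end{cases}\qquad r_{\lambda,\mu}=\begin{cases}1&\text{if }\lambda\mu<1,\\ \frac{-\log\lambda}{\log\mu}&\text{if }\lambda\mu\ge1.\end{cases}$$ Map and rotation number. For $1-\lambda<\delta<d_{\lambda,\mu}$ put $\eta=\frac{1-\delta}{\lambda}$ and let $f=f_{\lambda,\mu,\delta}:I\to I$ be defined by $f(x)=\lambda x+\delta$ if $0\le x<\eta$, and $f(x)=\mu(\lambda x+\delta-1)$ if $\eta\le x<1$. Its lift $F=F_{\lambda,\mu,\delta}:\mathbb R\to\mathbb R$ is $$F(x)=\begin{cases}\lambda x+\delta+(1-\lambda)\lfloor x\rfloor&\text{if }0\le\{x\}<\eta,\\ \mu(\lambda x+\delta-1)+1+(1-\lambda\mu)\lfloor x\rfloor&\text{if }\eta\le\{x\}<1.\end{cases}$$ $F$ is increasing, $F(x+1)=F(x)+1$ and $\{F(x)\}=f(\{x\})$. The rotation number of $f$ is $\rho_{\lambda,\mu,\delta}=\lim_{k\to\infty}F^k(x)/k$, which exists and does not depend on $x\in\mathbb R$ (a known fact). The function $\delta(\lambda,\mu,\rho)$. For positive reals with $0<\lambda<1$ and $0<\rho<r_{\lambda,\mu}$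 (so that $\lambda\mu^\rho<1$), set $$\sigma(\lambda,\mu,\rho)=\sum_{k\ge1}\left(\lfloor(k+1)\rho\rfloor-\lfloor k\rho\rfloor\right)\lambda^k\mu^{\lfloor k\rho\rfloor},\qquad \delta(\lambda,\mu,\rho)=\frac{(1-\lambda)(1+\mu\,\sigma(\lambda,\mu,\rho))}{1+(\mu-1)\sigma(\lambda,\mu,\rho)}.$$ For a point $\rho_0$, $\delta(\lambda,\mu,\rho_0^-)=\lim_{\rho\nearrow\rho_0}\delta(\lambda,\mu,\rho)$ denotes the left limit in $\rho$. *)

theory Defs
  imports "HOL-Analysis.Analysis"
begin

definition d_bound :: "real \<Rightarrow> real \<Rightarrow> real" where
  "d_bound l m = (if l * m < 1 then 1 else (m - l * m) / (m - 1))"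

definition r_bound :: "real \<Rightarrow> real \<Rightarrow> real" where
  "r_bound l m = (if l * m < 1 then 1 else - ln l / ln m)"

definition eta :: "real \<Rightarrow> real \<Rightarrow> real" where
  "eta l \<delta> = (1 - \<delta>) / l"

text \<open>The map is only meaningful on the interval \<open>{0..<1}\<close>.\<close>
definition f_map :: "real \<Rightarrow> real \<Rightarrow> real \<Rightarrow> real \<Rightarrow> real" where
  "f_map l m \<delta> x =
     (if x < eta l \<delta> then l * x + \<delta> else m * (l * x + \<delta> - 1))"

definition F_lift :: "real \<Rightarrow> real \<Rightarrow> real \<Rightarrow> real \<Rightarrow> real" where
  "F_lift l m \<delta> x =
     (if frac x < eta l \<delta>
      then l * x + \<delta> + (1 - l) * of_int \<lfloor>x\<rfloor>
      else m * (l * x + \<delta> - 1) + 1 + (1 - l * m) * of_int \<lfloor>x\<rfloor>)"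

text \<open>The definite description picks the common value of the limits over all starting
  points; it is meaningful whenever these limits exist and agree, as they do for
  increasing maps commuting with the unit translation.\<close>
definition rotation_number :: "(real \<Rightarrow> real) \<Rightarrow> real" where
  "rotation_number F = (THE r. \<forall>x. (\<lambda>k. (F ^^ k) x / real k) \<longlonglongrightarrow> r)"

definition rho :: "real \<Rightarrow> real \<Rightarrow> real \<Rightarrow> real" where
  "rho l m \<delta> = rotation_number (F_lift l m \<delta>)"

text \<open>The series over \<open>k \<ge> 1\<close> is indexed by \<open>k = Suc n\<close>.  The exponents of \<open>m\<close> are
  integers, nonnegative for \<open>r > 0\<close>.\<close>
definition sigma :: "real \<Rightarrow> real \<Rightarrow> real \<Rightarrow> real" where
  "sigma l m r =
     (\<Sum>n. let k = Suc n in
        of_int (\<lfloor>real (k + 1) * r\<rfloor> - \<lfloor>real k * r\<rfloor>) * l ^ k * m powi \<lfloor>real k * r\<rfloor>)"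

definition delta :: "real \<Rightarrow> real \<Rightarrow> real \<Rightarrow> real" where
  "delta l m r = (1 - l) * (1 + m * sigma l m r) / (1 + (m - 1) * sigma l m r)"

definition delta_left :: "real \<Rightarrow> real \<Rightarrow> real \<Rightarrow> real" where
  "delta_left l m r0 = Lim (at_left r0) (\<lambda>r. delta l m r)"

text \<open>For \<open>q = 2\<close> the range of summation is \<open>{1..0}\<close>, hence the sum is \<open>0\<close>.\<close>
definition S_sum :: "real \<Rightarrow> real \<Rightarrow> nat \<Rightarrow> nat \<Rightarrow> real" where
  "S_sum l m p q =
     (\<Sum>k = 1..q - 2.
        of_int (\<lfloor>real (k + 1) * (real p / real q)\<rfloor> - \<lfloor>real k * (real p / real q)\<rfloor>)
          * l ^ k * m powi \<lfloor>real k * (real p / real q)\<rfloor>)"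

lemma F_lift_add_one: "F_lift l m \<delta> (x + 1) = F_lift l m \<delta> x + 1"
  by (simp add: F_lift_def frac_def algebra_simps)

lemma d_bound_imp:
  assumes "0 < l" "l < 1" "0 < m" "1 - l < \<delta>" "\<delta> < d_bound l m"
  shows "\<delta> < 1" "m * (l + \<delta> - 1) < \<delta>"
proof -
  have "\<delta> < 1 \<and> m * (l + \<delta> - 1) < \<delta>"
  proof (cases "l * m < 1")
    case True
    then have d: "\<delta> < 1" using assms by (simp add: d_bound_def)
    show ?thesis
    proof (cases "m \<le> 1")
      case True
      have "m * (l + \<delta> - 1) \<le> 1 * (l + \<delta> - 1)"
        using assms True by (intro mult_right_mono) auto
      moreover have "l + \<delta> - 1 < \<delta>" using assms by simp
      ultimately have "m * (l + \<delta> - 1) < \<delta>"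
        by (simp only: mult_1_left)
      then show ?thesis using d by simp
    next
      case False
      then have "(m - 1) * \<delta> < (m - 1) * 1"
        using d by (intro mult_strict_left_mono) auto
      then show ?thesis using \<open>l * m < 1\<close> d by (simp add: algebra_simps)
    qed
  next
    case False
    have m1: "m > 1"
    proof (rule ccontr)
      assume "\<not> m > 1"
      then have "l * m \<le> l * 1" using assms by (intro mult_left_mono) auto
      also have "l * 1 < 1" using assms by simp
      finally show False using False by simp
    qed
    have d: "(m - 1) * \<delta> < m - l * m"
      using False assms m1 by (simp add: d_bound_def field_simps)
    then have "(m - 1) * \<delta> < (m - 1) * 1" using False by simp
    then have "\<delta> < 1" using m1 by (simp only: mult_less_cancel_left_pos)
    then show ?thesis using d by (simp add: algebra_simps)
  qed
  then show "\<delta> < 1" "m * (l + \<delta> - 1) < \<delta>" by auto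
qed

lemma f_map_in_unit:
  assumes "0 < l" "l < 1" "0 < m" "1 - l < \<delta>" "\<delta> < d_bound l m" "0 \<le> x" "x < 1"
  shows "0 \<le> f_map l m \<delta> x" "f_map l m \<delta> x < 1"
proof -
  note d = d_bound_imp[OF assms(1-5)]
  have "0 \<le> f_map l m \<delta> x \<and> f_map l m \<delta> x < 1"
  proof (cases "x < eta l \<delta>")
    case True
    then have "l * x + \<delta> < 1" using assms by (simp add: eta_def field_simps)
    moreover have "0 \<le> l * x" using assms by simp
    ultimately show ?thesis using True assms by (simp add: f_map_def)
  next
    case False
    then have "0 \<le> l * x + \<delta> - 1" using assms by (simp add: eta_def field_simps)
    moreover have "l * x \<le> l * 1" using assms by (intro mult_left_mono) auto
    ultimately have "0 \<le> m * (l * x + \<delta> - 1)" "m * (l * x + \<delta> - 1) \<le> m * (l + \<delta> - 1)"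
      using assms by (auto intro!: mult_left_mono)
    then show ?thesis using False d by (simp add: f_map_def)
  qed
  then show "0 \<le> f_map l m \<delta> x" "f_map l m \<delta> x < 1" by auto
qed

lemma frac_F_lift:
  assumes "0 < l" "l < 1" "0 < m" "1 - l < \<delta>" "\<delta> < d_bound l m"
  shows "frac (F_lift l m \<delta> x) = f_map l m \<delta> (frac x)"
proof -
  have "F_lift l m \<delta> x = f_map l m \<delta> (frac x)
      + of_int (\<lfloor>x\<rfloor> + (if frac x < eta l \<delta> then 0 else 1))"
  proof (cases "frac x < eta l \<delta>")
    case True
    then show ?thesis by (simp only: F_lift_def f_map_def if_True) (simp add: frac_def algebra_simps)
  next
    case False
    then show ?thesis by (simp only: F_lift_def f_map_def if_False) (simp add: frac_def algebra_simps)
  qed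
  moreover have "0 \<le> f_map l m \<delta> (frac x)" "f_map l m \<delta> (frac x) < 1"
    using f_map_in_unit[OF assms, of "frac x"] by (auto simp: frac_lt_1)
  ultimately show ?thesis
    by (simp add: frac_unique_iff)
qed

end

theory Submission
  imports Defs
begin

text \<open>
  Write \<open>w n = l\<^sup>n m\<^bsup>\<lfloor>(n + 1) r\<rfloor>\<^esup>\<close> and \<open>T = \<Sum>n. w n\<close>. The iterates of the gap that \<open>f\<close> omits between
  \<open>f(1\<^sup>-)\<close> and \<open>f(0) = \<delta>\<close> have lengths proportional to \<open>w n\<close>, so for irrational \<open>r\<close> the jump function with jumps
  \<open>w n / T\<close> at the points congruent to \<open>(n + 1) r\<close> modulo 1 is a candidate for a map \<open>\<phi>\<close> with
  \<open>F (\<phi> y) = \<phi> (y + r)\<close>. Comparing coefficients, this holds exactly for \<open>\<delta> = \<phi>(r)\<close>, which is \<open>delta l m r\<close>,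
  and it forces the rotation number to be \<open>r\<close>.

  Since \<open>F\<close> is pointwise monotone in \<open>\<delta>\<close>, so is the rotation number; hence \<open>delta l m\<close> is strictly
  increasing on the irrationals. By dominated convergence it has one-sided limits at every \<open>r\<^sub>0\<close>, with value
  \<open>delta l m r\<^sub>0\<close> on the right, and these limits along irrationals bound the set where the rotation number is
  \<open>r\<^sub>0\<close>. So rational rotation numbers need no separate dynamical argument, only the summation of a series
  with periodic exponents, and continuity follows from monotonicity and surjectivity.
\<close>

subsection \<open>Rotation numbers of monotone maps of degree one\<close>

definition degree_one :: "(real \<Rightarrow> real) \<Rightarrow> bool" where
  "degree_one G \<longleftrightarrow> mono G \<and> (\<forall>x. G (x + 1) = G x + 1)"

lemma degree_one_mono: "degree_one G \<Longrightarrow> x \<le> y \<Longrightarrow> G x \<le> G y"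
  by (auto simp: degree_one_def mono_def)

lemma degree_one_add_nat: "degree_one G \<Longrightarrow> G (x + real n) = G x + real n"
proof (induction n)
  case (Suc n)
  have "G (x + real (Suc n)) = G ((x + real n) + 1)" by (simp add: algebra_simps)
  also have "\<dots> = G (x + real n) + 1" using Suc by (simp add: degree_one_def)
  finally show ?case using Suc by simp
qed simp

lemma degree_one_add_int:
  assumes "degree_one G" shows "G (x + of_int n) = G x + of_int n"
proof (cases "n \<ge> 0")
  case True
  then show ?thesis using degree_one_add_nat[OF assms, of x "nat n"] by simp
next
  case False
  then show ?thesis using degree_one_add_nat[OF assms, of "x + of_int n" "nat (- n)"] by simp
qed

lemma degree_one_funpow: "degree_one G \<Longrightarrow> degree_one (G ^^ k)"
proof (induction k)
  case (Suc k)
  then show ?case by (auto simp: degree_one_def mono_def)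
qed (auto simp: degree_one_def mono_def)

text \<open>Translating \<open>y\<close> by an integer leaves its displacement unchanged. With the
  integer part of \<open>x - y\<close> as the translation, monotonicity puts \<open>x - y\<close>
  and \<open>G x - G y\<close> into the same interval of length one.\<close>

lemma degree_one_displacement:
  assumes "degree_one G" shows "\<bar>(G x - x) - (G y - y)\<bar> \<le> 1"
proof -
  define n where "n = \<lfloor>x - y\<rfloor>"
  have n: "y + of_int n \<le> x" "x \<le> y + of_int (n + 1)" "x < y + of_int n + 1"
    unfolding n_def by linarith+
  have "G y + of_int n \<le> G x" "G x \<le> G y + of_int (n + 1)"
    using degree_one_mono[OF assms n(1)] degree_one_mono[OF assms n(2)]
    by (simp_all only: degree_one_add_int[OF assms])
  with n show ?thesis by (auto simp: abs_le_iff)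
qed

text \<open>The displacement of \<open>G ^^ k\<close> varies by at most one, so following the orbit
  in blocks of length \<open>k\<close> costs an error of one per block after the first. For
  \<open>j > 0\<close> there are only \<open>j - 1\<close> such errors, hence the separate
  correction at \<open>j = 0\<close>.\<close>

lemma funpow_orbit_bounds:
  assumes "degree_one G"
  shows "real j * ((G ^^ k) 0 - 1) \<le> (G ^^ (j * k)) 0 - 1 + (if j = 0 then 1 else 0)"
    and "(G ^^ (j * k)) 0 + 1 - (if j = 0 then 1 else 0) \<le> real j * ((G ^^ k) 0 + 1)"
proof -
  have step: "\<bar>(G ^^ (Suc j * k)) 0 - (G ^^ (j * k)) 0 - (G ^^ k) 0\<bar> \<le> 1" for j
    using degree_one_displacement[OF degree_one_funpow[OF assms, of k], of "(G ^^ (j * k)) 0" 0]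
    by (simp add: funpow_add)
  show "real j * ((G ^^ k) 0 - 1) \<le> (G ^^ (j * k)) 0 - 1 + (if j = 0 then 1 else 0)"
  proof (induction j)
    case (Suc j)
    then show ?case using step[of j] by (cases "j = 0") (auto simp: algebra_simps abs_le_iff)
  qed simp
  show "(G ^^ (j * k)) 0 + 1 - (if j = 0 then 1 else 0) \<le> real j * ((G ^^ k) 0 + 1)"
  proof (induction j)
    case (Suc j)
    then show ?case using step[of j] by (cases "j = 0") (auto simp: algebra_simps abs_le_iff)
  qed simp
qed

text \<open>Lower estimates \<open>(a j - 1) / j\<close> and upper estimates
  \<open>(a k + 1) / k\<close> are compared through the common time \<open>j * k\<close>. The
  supremum of the lower ones is then within \<open>1 / k\<close> of \<open>a k / k\<close> for every
  \<open>k > 0\<close>.\<close>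

lemma rotation_exists:
  assumes "degree_one G"
  shows "\<exists>r. \<forall>x. (\<lambda>k. (G ^^ k) x / real k) \<longlonglongrightarrow> r"
proof -
  define a where "a k = (G ^^ k) 0" for k
  have cross: "(a j - 1) / real j \<le> (a k + 1) / real k" if "j > 0" "k > 0" for j k
  proof -
    have "real k * (a j - 1) \<le> a (j * k) - 1" "a (j * k) + 1 \<le> real j * (a k + 1)"
      using funpow_orbit_bounds(1)[OF assms, of k j] funpow_orbit_bounds(2)[OF assms, of j k] that
      by (auto simp: a_def mult.commute)
    then show ?thesis using that by (simp add: divide_simps mult_ac)
  qed
  define r where "r = (SUP j\<in>{1..}. (a j - 1) / real j)"
  have lower: "(a k - 1) / real k \<le> r" if "k > 0" for k
    unfolding r_def using that cross[of _ 1]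
    by (intro cSUP_upper bdd_aboveI2[where M = "(a 1 + 1) / real 1"]) auto
  have upper: "r \<le> (a k + 1) / real k" if "k > 0" for k
    unfolding r_def using that cross by (intro cSUP_least) auto
  have "(\<lambda>k. (G ^^ k) x / real k) \<longlonglongrightarrow> r" for x
  \<comment> \<open>The shift by one discards \<open>k = 0\<close>, where division by zero gives 0
    and the bounds may fail.\<close>
  proof (rule LIMSEQ_offset[of _ 1], rule tendsto_sandwich)
    \<comment> \<open>One unit bounds the distance of \<open>a k\<close> from \<open>r * k\<close>,
      one the change of displacement between the starting points 0 and \<open>x\<close>, and the
      rest is the start \<open>x\<close> itself.\<close>
    let ?c = "\<bar>x\<bar> + 2"
    have b: "r - ?c / real k \<le> (G ^^ k) x / real k \<and> (G ^^ k) x / real k \<le> r + ?c / real k"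
      if "k > 0" for k
    proof -
      have "\<bar>((G ^^ k) x - x) - (a k - 0)\<bar> \<le> 1"
        unfolding a_def by (rule degree_one_displacement[OF degree_one_funpow[OF assms]])
      moreover have "a k - 1 \<le> r * real k" "r * real k \<le> a k + 1"
        using lower[OF that] upper[OF that] that by (auto simp: field_simps)
      ultimately have "r * real k - ?c \<le> (G ^^ k) x \<and> (G ^^ k) x \<le> r * real k + ?c"
        by (auto simp: abs_le_iff abs_if split: if_splits)
      then have "(r * real k - ?c) / real k \<le> (G ^^ k) x / real k
          \<and> (G ^^ k) x / real k \<le> (r * real k + ?c) / real k"
        by (auto intro: divide_right_mono)
      then show ?thesis using that by (simp add: diff_divide_distrib add_divide_distrib)
    qed
    show "\<forall>\<^sub>F k in sequentially. r - ?c / real (k + 1) \<le> (G ^^ (k + 1)) x / real (k + 1)"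
      using b by (intro always_eventually allI) (metis add_gr_0 zero_less_one)
    show "\<forall>\<^sub>F k in sequentially. (G ^^ (k + 1)) x / real (k + 1) \<le> r + ?c / real (k + 1)"
      using b by (intro always_eventually allI) (metis add_gr_0 zero_less_one)
    have "(\<lambda>k. ?c / real (k + 1)) \<longlonglongrightarrow> 0"
      using LIMSEQ_ignore_initial_segment[OF lim_const_over_n[of ?c], of 1] by simp
    from tendsto_diff[OF tendsto_const this] tendsto_add[OF tendsto_const this]
    show "(\<lambda>k. r - ?c / real (k + 1)) \<longlonglongrightarrow> r" "(\<lambda>k. r + ?c / real (k + 1)) \<longlonglongrightarrow> r"
      by (metis diff_zero, metis add_0_right)
  qed
  then show ?thesis by blast
qed

lemma rotation_number_tendsto:
  assumes "degree_one G"
  shows "(\<lambda>k. (G ^^ k) x / real k) \<longlonglongrightarrow> rotation_number G"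
proof -
  obtain r where r: "\<forall>x. (\<lambda>k. (G ^^ k) x / real k) \<longlonglongrightarrow> r"
    using rotation_exists[OF assms] by blast
  then have "rotation_number G = r"
    unfolding rotation_number_def by (intro the_equality) (auto intro: LIMSEQ_unique)
  with r show ?thesis by simp
qed

lemma rotation_number_eqI:
  assumes "degree_one G" "(\<lambda>k. (G ^^ k) x / real k) \<longlonglongrightarrow> r"
  shows "rotation_number G = r"
  using LIMSEQ_unique[OF rotation_number_tendsto[OF assms(1)] assms(2)] .

lemma rotation_number_mono:
  assumes "degree_one G" "degree_one K" "\<And>x. G x \<le> K x"
  shows "rotation_number G \<le> rotation_number K"
proof (rule tendsto_le[OF sequentially_bot rotation_number_tendsto[OF assms(2)]
      rotation_number_tendsto[OF assms(1)]])
  have "(G ^^ k) 0 \<le> (K ^^ k) 0" for k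
  proof (induction k)
    case (Suc k)
    have "(G ^^ Suc k) 0 \<le> G ((K ^^ k) 0)" using degree_one_mono[OF assms(1) Suc] by simp
    also have "\<dots> \<le> (K ^^ Suc k) 0" using assms(3) by simp
    finally show ?case .
  qed simp
  then show "\<forall>\<^sub>F k in sequentially. (G ^^ k) 0 / real k \<le> (K ^^ k) 0 / real k"
    by (intro always_eventually allI divide_right_mono) auto
qed

lemma degree_one_translation: "degree_one (\<lambda>x. x + c)"
  by (auto simp: degree_one_def mono_def)

lemma rotation_number_translation: "rotation_number (\<lambda>x. x + c) = c"
proof (rule rotation_number_eqI[OF degree_one_translation])
  have iter: "((\<lambda>x. x + c) ^^ k) 0 = real k * c" for k
    by (induction k) (auto simp: algebra_simps)
  show "(\<lambda>k. ((\<lambda>x. x + c) ^^ k) 0 / real k) \<longlonglongrightarrow> c"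
    unfolding iter by (rule tendsto_eventually, rule eventually_sequentiallyI[of 1]) auto
qed

lemma rotation_number_le:
  assumes "degree_one G" "\<And>x. G x \<le> x + c" shows "rotation_number G \<le> c"
  using rotation_number_mono[OF assms(1) degree_one_translation assms(2)]
  by (simp add: rotation_number_translation)

lemma rotation_number_ge:
  assumes "degree_one G" "\<And>x. x + c \<le> G x" shows "c \<le> rotation_number G"
  using rotation_number_mono[OF degree_one_translation assms(1,2)]
  by (simp add: rotation_number_translation)

text \<open>The orbit of \<open>\<phi> 0\<close> is \<open>\<phi> (k * r)\<close>, which stays
  within \<open>c\<close> of \<open>k * r\<close>. Neither continuity nor monotonicity of
  \<open>\<phi>\<close> enters, so a jump function is admissible.\<close>

lemma rotation_number_semiconj:
  assumes G: "degree_one G" and dist: "\<And>y. \<bar>\<phi> y - y\<bar> \<le> c"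
    and conj: "\<And>y. G (\<phi> y) = \<phi> (y + r)"
  shows "rotation_number G = r"
proof (rule rotation_number_eqI[OF G, of "\<phi> 0"])
  have iter: "(G ^^ k) (\<phi> 0) = \<phi> (real k * r)" for k
    by (induction k) (simp_all add: conj algebra_simps)
  have "(\<lambda>k. (\<phi> (real k * r) - real k * r) / real k) \<longlonglongrightarrow> 0"
  proof (rule Lim_null_comparison[OF always_eventually lim_const_over_n])
    show "\<forall>k. norm ((\<phi> (real k * r) - real k * r) / real k) \<le> c / real k"
      using dist by (auto intro!: divide_right_mono simp: abs_divide)
  qed
  then have "(\<lambda>k. (\<phi> (real k * r) - real k * r) / real k + r) \<longlonglongrightarrow> 0 + r"
    by (intro tendsto_intros)
  then have "(\<lambda>k. (\<phi> (real k * r) - real k * r) / real k + r) \<longlonglongrightarrow> r" by simp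
  then show "(\<lambda>k. (G ^^ k) (\<phi> 0) / real k) \<longlonglongrightarrow> r"
    unfolding iter
    by (rule Lim_transform_eventually)
      (auto simp: field_simps intro!: eventually_sequentiallyI[of 1])
qed

subsection \<open>Monotone dependence on the parameter\<close>

text \<open>Both branches of the lift as one continuous increasing function of
  \<open>t = l * frac x + \<delta>\<close>, with slope 1 up to \<open>t = 1\<close> and slope
  \<open>m\<close> beyond. Monotonicity in \<open>x\<close> inside a unit interval and monotonicity
  in \<open>\<delta>\<close> thus become the same fact.\<close>

definition fold_up :: "real \<Rightarrow> real \<Rightarrow> real" where
  "fold_up m t = (if t < 1 then t else 1 + m * (t - 1))"

lemma fold_up_mono:
  assumes "m > 0" "s \<le> t" shows "fold_up m s \<le> fold_up m t"
proof -
  have "1 + m * (s - 1) \<le> 1 + m * (t - 1)" using assms by simp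
  moreover have "0 \<le> m * (t - 1)" if "t \<ge> 1" using assms that by simp
  ultimately show ?thesis using assms(2) by (auto simp: fold_up_def)
qed

lemma F_lift_eq_fold_up:
  assumes "l > 0" shows "F_lift l m \<delta> x = fold_up m (l * frac x + \<delta>) + of_int \<lfloor>x\<rfloor>"
proof -
  have "frac x < eta l \<delta> \<longleftrightarrow> l * frac x + \<delta> < 1"
    using assms by (auto simp: eta_def field_simps)
  moreover have "l * x = l * frac x + l * of_int \<lfloor>x\<rfloor>"
    by (simp add: frac_def algebra_simps)
  ultimately show ?thesis
    unfolding F_lift_def fold_up_def by (simp add: algebra_simps)
qed

lemma F_lift_mono_delta:
  assumes "l > 0" "m > 0" "\<delta> \<le> \<delta>'" shows "F_lift l m \<delta> x \<le> F_lift l m \<delta>' x"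
  using assms by (simp add: F_lift_eq_fold_up fold_up_mono)

lemma degree_one_F_lift:
  assumes "0 < l" "l < 1" "0 < m" "1 - l < \<delta>" "\<delta> < d_bound l m"
  shows "degree_one (F_lift l m \<delta>)"
  unfolding degree_one_def
proof (intro conjI monoI allI)
  note d = d_bound_imp[OF assms]
  fix x y :: real assume xy: "x \<le> y"
  show "F_lift l m \<delta> x \<le> F_lift l m \<delta> y"
  proof (cases "\<lfloor>x\<rfloor> = \<lfloor>y\<rfloor>")
    case True
    then have "frac x \<le> frac y" using xy by (simp add: frac_def)
    then show ?thesis using True assms by (simp add: F_lift_eq_fold_up fold_up_mono)
  next
    case False
    then have fl: "\<lfloor>x\<rfloor> + 1 \<le> \<lfloor>y\<rfloor>" using floor_mono[OF xy] by linarith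
    have "frac x \<le> 1" "0 \<le> frac y" using frac_lt_1[of x] by auto
    then have "l * frac x + \<delta> \<le> l + \<delta>" "\<delta> \<le> l * frac y + \<delta>"
      using mult_left_mono[of "frac x" 1 l] assms by auto
    then have "fold_up m (l * frac x + \<delta>) \<le> fold_up m (l + \<delta>)"
       "fold_up m \<delta> \<le> fold_up m (l * frac y + \<delta>)"
      using assms fold_up_mono by blast+
    \<comment> \<open>This is the condition \<open>m * (l + \<delta> - 1) < \<delta>\<close>
      provided by \<open>d_bound\<close>: the left limit of the lift at an integer does not exceed
      its value there.\<close>
    moreover have "fold_up m (l + \<delta>) \<le> fold_up m \<delta> + 1"
      using d assms by (simp add: fold_up_def algebra_simps)
    ultimately show ?thesis using fl assms by (simp add: F_lift_eq_fold_up)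
  qed
qed (rule F_lift_add_one)

lemma rho_mono:
  assumes "0 < l" "l < 1" "0 < m" "1 - l < \<delta>" "\<delta> \<le> \<delta>'" "\<delta>' < d_bound l m"
  shows "rho l m \<delta> \<le> rho l m \<delta>'"
  unfolding rho_def using assms
  by (intro rotation_number_mono degree_one_F_lift F_lift_mono_delta) auto

lemma rho_pos:
  assumes "0 < l" "l < 1" "0 < m" "1 - l < \<delta>" "\<delta> < d_bound l m"
  shows "0 < rho l m \<delta>"
proof -
  define e where "e = l + \<delta> - 1"
  have e: "e > 0" using assms by (simp add: e_def)
  \<comment> \<open>On the first branch the displacement is at least \<open>e\<close>; at the right
    end of the unit interval it tends to \<open>m * e\<close>.\<close>
  define c where "c = min e (m * e)"
  have "c > 0" using e assms by (simp add: c_def)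
  moreover have "c \<le> rho l m \<delta>"
    unfolding rho_def
  proof (rule rotation_number_ge[OF degree_one_F_lift[OF assms]])
    fix x :: real
    define t where "t = frac x"
    have t: "0 \<le> t" "t < 1" by (simp_all add: t_def frac_lt_1)
    have "t + c \<le> fold_up m (l * t + \<delta>)"
    proof (cases "l * t + \<delta> < 1")
      case True
      have "(1 - l) * t \<le> (1 - l) * 1" using t assms by (intro mult_left_mono) auto
      then have "t + e \<le> l * t + \<delta>" by (simp add: e_def algebra_simps)
      then show ?thesis using True by (simp add: fold_up_def c_def)
    next
      case False
      define s where "s = l * t + \<delta> - 1"
      have s: "s \<ge> 0" using False by (simp add: s_def)
      have "l * (1 - t) = e - s" by (simp add: e_def s_def algebra_simps)
      moreover have "l * (1 - t) \<le> 1 - t" "0 \<le> l * (1 - t)"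
        using t assms mult_right_mono[of l 1 "1 - t"] by auto
      ultimately have es: "e - s \<le> 1 - t" "s \<le> e" by auto
      \<comment> \<open>As \<open>s\<close> runs from 0 to \<open>e\<close>, the right side
        interpolates linearly between \<open>e\<close> and \<open>m * e\<close>; by
        \<open>es\<close> it bounds the displacement on the second branch from below.\<close>
      have "c \<le> (e - s) + m * s"
      proof (cases "m \<le> 1")
        case True
        have "m * (e - s) \<le> 1 * (e - s)" using True es by (intro mult_right_mono) auto
        then show ?thesis by (simp add: c_def algebra_simps min_le_iff_disj)
      next
        case False
        then have "s * 1 \<le> s * m" using s by (intro mult_left_mono) auto
        then show ?thesis by (simp add: c_def algebra_simps min_le_iff_disj)
      qed
      then show ?thesis using es False by (simp add: fold_up_def s_def)
    qed
    then show "x + c \<le> F_lift l m \<delta> x"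
      using assms by (simp add: F_lift_eq_fold_up t_def frac_def)
  qed
  ultimately show ?thesis by simp
qed

lemma rho_less_one:
  assumes "0 < l" "l < 1" "0 < m" "1 - l < \<delta>" "\<delta> < d_bound l m"
  shows "rho l m \<delta> < 1"
proof -
  note d = d_bound_imp[OF assms]
  have "rho l m \<delta> \<le> \<delta>"
    unfolding rho_def
  proof (rule rotation_number_le[OF degree_one_F_lift[OF assms]])
    fix x :: real
    define t where "t = frac x"
    have t: "0 \<le> t" "t < 1" by (simp_all add: t_def frac_lt_1)
    have "fold_up m (l * t + \<delta>) \<le> t + \<delta>"
    proof (cases "l * t + \<delta> < 1")
      case True
      have "l * t \<le> 1 * t" using t assms by (intro mult_right_mono) auto
      then show ?thesis using True by (simp add: fold_up_def)
    next
      case False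
      define e s where "e = l + \<delta> - 1" and "s = l * t + \<delta> - 1"
      have e: "e > 0" "m * e \<le> \<delta>" using assms d by (simp_all add: e_def)
      have s: "s \<ge> 0" using False by (simp add: s_def)
      have u: "l * (1 - t) = e - s" by (simp add: e_def s_def algebra_simps)
      \<comment> \<open>The goal \<open>m * s \<le> \<delta> - (1 - t)\<close> is proved after
        multiplication by \<open>e\<close>, so that \<open>m * e \<le> \<delta>\<close> eliminates
        \<open>m\<close>. The other ingredient is \<open>e \<le> \<delta> * l\<close>, which is this
        product expanded.\<close>
      have "0 \<le> (1 - l) * (1 - \<delta>)" using assms d by simp
      then have "e \<le> \<delta> * l" by (simp add: e_def algebra_simps)
      then have "e * (1 - t) \<le> \<delta> * l * (1 - t)" using t by (intro mult_right_mono) auto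
      also have "\<dots> = \<delta> * (e - s)" using u by (simp add: mult.assoc)
      finally have "e * (1 - t) \<le> \<delta> * (e - s)" .
      moreover have "m * e * s \<le> \<delta> * s" using e s by (intro mult_right_mono) auto
      ultimately have "e * (m * s) \<le> e * (\<delta> - (1 - t))" by (simp add: algebra_simps)
      then have "m * s \<le> \<delta> - (1 - t)" using e by (simp only: mult_le_cancel_left_pos)
      then show ?thesis using False by (simp add: fold_up_def s_def)
    qed
    then show "F_lift l m \<delta> x \<le> x + \<delta>"
      using assms by (simp add: F_lift_eq_fold_up t_def frac_def)
  qed
  then show ?thesis using d by simp
qed

subsection \<open>Series with floor exponents\<close>

text \<open>Below \<open>r_bound\<close> the geometric series that dominates \<open>sigma\<close>
  converges; when \<open>l * m \<ge> 1\<close>, the bound is the exponent at which this ratio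
  reaches one.\<close>

lemma mult_powr_less_one:
  assumes "0 < l" "l < 1" "0 < m" "0 < r" "r < r_bound l m"
  shows "l * m powr r < 1"
proof (cases "m \<le> 1")
  case True
  then have "m powr r \<le> 1" using assms by (intro powr_le1) auto
  then have "l * m powr r \<le> l * 1" using assms by (intro mult_left_mono) auto
  with \<open>l < 1\<close> show ?thesis by linarith
next
  case m1: False
  show ?thesis
  proof (cases "l * m < 1")
    case True
    then have "m powr r < m powr 1" using m1 assms by (intro powr_less_mono) (auto simp: r_bound_def)
    then have "l * m powr r < l * m" using assms by simp
    then show ?thesis using True by simp
  next
    case False
    then have "r * ln m < - ln l" using assms m1 by (simp add: r_bound_def field_simps)
    then have "ln (l * m powr r) < 0" using assms by (simp add: ln_mult ln_powr)
    then show ?thesis using assms by (simp add: ln_less_zero_iff)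
  qed
qed

lemma one_less_of_one_le_mult:
  fixes l m :: real
  assumes "\<not> l * m < 1" "0 < l" "l < 1" shows "1 < m"
proof (rule ccontr)
  assume "\<not> 1 < m"
  then have "l * m \<le> l * 1" using assms by (intro mult_left_mono) auto
  then show False using assms by linarith
qed

lemma r_bound_le_one:
  assumes "0 < l" "l < 1" "0 < m" shows "r_bound l m \<le> 1"
proof (cases "l * m < 1")
  case False
  then have "m > 1" using assms by (intro one_less_of_one_le_mult)
  moreover have "0 \<le> ln (l * m)" using False by simp
  ultimately show ?thesis using False assms by (simp add: r_bound_def ln_mult field_simps)
qed (simp add: r_bound_def)

text \<open>For \<open>m \<le> 1\<close> the factor \<open>m powi e\<close> is at most one, and for
  \<open>m > 1\<close> it grows with the exponent, which is bounded by \<open>k * r\<close>. The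
  maximum covers both cases.\<close>

lemma weight_le_power:
  fixes e :: int
  assumes "0 < l" "0 < m" "0 \<le> e" "of_int e \<le> real k * r"
  shows "l ^ k * m powi e \<le> max l (l * m powr r) ^ k"
proof (cases "m \<le> 1")
  case True
  then have "m powi e \<le> 1" using assms by (intro power_int_le_one) auto
  then have "l ^ k * m powi e \<le> l ^ k * 1" using assms by (intro mult_left_mono) auto
  also have "\<dots> \<le> max l (l * m powr r) ^ k" using assms by (auto intro: power_mono)
  finally show ?thesis .
next
  case False
  have "m powi e = m powr of_int e" using assms by (simp add: powr_real_of_int')
  also have "\<dots> \<le> m powr (real k * r)" using False assms by (intro powr_mono) auto
  also have "\<dots> = (m powr r) ^ k" using assms by (simp add: powr_powr mult.commute flip: powr_realpow)
  finally have "l ^ k * m powi e \<le> (l * m powr r) ^ k"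
    using assms by (simp add: power_mult_distrib)
  also have "\<dots> \<le> max l (l * m powr r) ^ k" using assms by (intro power_mono) auto
  finally show ?thesis .
qed

text \<open>The exponent \<open>e n\<close> stands for \<open>\<lfloor>(n + 1) r\<rfloor>\<close> or for \<open>\<lceil>(n + 1) r\<rceil> - 1\<close>, its limit from the
  left.\<close>

locale exponents =
  fixes l m r :: real and e :: "nat \<Rightarrow> int"
  assumes l: "0 < l" "l < 1" and m: "0 < m" and r: "0 < r" and lm: "l * m powr r < 1"
    and e_0: "e 0 = 0"
    and e_step: "e (Suc n) = e n \<or> e (Suc n) = e n + 1"
    and e_le: "of_int (e n) \<le> real (Suc n) * r"
begin

definition w :: "nat \<Rightarrow> real" where "w n = l ^ n * m powi e n"

definition T :: real where "T = (\<Sum>n. w n)"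

text \<open>This is \<open>sigma\<close> for general exponents: the term with index \<open>n\<close>
  is the one for \<open>k = Suc n\<close>, whose floor is \<open>e n\<close>.\<close>

definition s :: real where
  "s = (\<Sum>n. of_int (e (Suc n) - e n) * l ^ Suc n * m powi e n)"

text \<open>The ratio of the geometric majorant depends on the growth rate \<open>r\<close> but not
  on \<open>e\<close>, so one majorant serves all exponent sequences of that rate.\<close>

definition \<theta> :: real where "\<theta> = max l (l * m powr r)"

lemma theta: "0 < \<theta>" "\<theta> < 1"
  using l lm by (auto simp: \<theta>_def)

lemma e_nonneg: "0 \<le> e n"
proof (induction n)
  case (Suc n)
  then show ?case using e_step[of n] by auto
qed (simp add: e_0)

lemma w_pos: "0 < w n"
  using l m by (simp add: w_def)

lemma term_bound: "l ^ Suc n * m powi e n \<le> \<theta> ^ Suc n"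
  unfolding \<theta>_def using l m e_nonneg e_le by (intro weight_le_power) auto

lemma summable_theta: "summable (\<lambda>n. \<theta> ^ Suc n)"
  using theta by (simp add: summable_Suc_iff)

lemma summable_w: "summable w"
proof (rule summable_comparison_test'[where N = 0])
  show "summable (\<lambda>n. inverse l * \<theta> ^ Suc n)" by (intro summable_mult summable_theta)
  have "norm (w n) = inverse l * (l ^ Suc n * m powi e n)" for n
    using l m by (simp add: w_def abs_mult)
  then show "norm (w n) \<le> inverse l * \<theta> ^ Suc n" for n
    using term_bound l by (simp only:) (intro mult_left_mono, auto)
qed

lemma summable_w_bounded:
  assumes "\<And>n. \<bar>g n\<bar> \<le> C" shows "summable (\<lambda>n. w n * g n)"
proof (rule summable_comparison_test'[where N = 0])
  show "summable (\<lambda>n. w n * C)" by (intro summable_mult2 summable_w)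
  show "norm (w n * g n) \<le> w n * C" for n
    using w_pos[of n] assms by (simp add: abs_mult)
qed

lemma step_bounded: "\<bar>real_of_int (e (Suc n) - e n)\<bar> \<le> 1"
  using e_step[of n] by auto

lemma s_term_eq: "of_int (e (Suc n) - e n) * l ^ Suc n * m powi e n = l * (w n * of_int (e (Suc n) - e n))"
  by (simp add: w_def)

lemma summable_s: "summable (\<lambda>n. of_int (e (Suc n) - e n) * l ^ Suc n * m powi e n)"
  unfolding s_term_eq by (intro summable_mult summable_w_bounded[of _ 1] step_bounded)

section \<open>Numerator, denominator and range of the parameter \<open>D\<close>\<close>

lemma T_pos: "0 < T"
  unfolding T_def using summable_w w_pos by (intro suminf_pos)

lemma T_shift: "(\<Sum>n. w (Suc n)) = T - 1"
proof -
  have "w 0 = 1" by (simp add: w_def e_0)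
  then show ?thesis unfolding T_def by (simp only: suminf_split_head[OF summable_w])
qed

lemma w_Suc_same: "e (Suc n) = e n \<Longrightarrow> w (Suc n) = l * w n"
  by (simp add: w_def)

lemma w_Suc_step: "e (Suc n) = e n + 1 \<Longrightarrow> w (Suc n) = l * m * w n"
  using m by (simp add: w_def power_int_add mult_ac)

text \<open>The difference \<open>w (Suc n) - l * w n\<close> vanishes where \<open>e\<close> stays
  constant and is \<open>m - 1\<close> times the term of \<open>s\<close> where \<open>e\<close>
  jumps. Summation relates \<open>s\<close> to \<open>T\<close> and shows that the denominator of
  \<open>D\<close> is positive.\<close>

lemma denom_eq: "1 + (m - 1) * s = (1 - l) * T"
proof -
  have "w (Suc n) - l * w n = (m - 1) * (of_int (e (Suc n) - e n) * l ^ Suc n * m powi e n)" for n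
    unfolding s_term_eq using e_step[of n] by (auto simp: w_Suc_same w_Suc_step algebra_simps)
  then have "(\<Sum>n. w (Suc n) - l * w n) = (m - 1) * s"
    unfolding s_def using suminf_mult[OF summable_s, of "m - 1"] by simp
  moreover have "(\<Sum>n. w (Suc n) - l * w n) = (T - 1) - l * T"
    using summable_w suminf_diff[of "\<lambda>n. w (Suc n)" "\<lambda>n. l * w n"] suminf_mult[OF summable_w, of l]
    by (simp add: T_shift summable_Suc_iff T_def summable_mult)
  ultimately show ?thesis by (simp add: algebra_simps)
qed

lemma numer_term:
  "w (Suc n) * of_int (e (Suc n) - e n) = m * (of_int (e (Suc n) - e n) * l ^ Suc n * m powi e n)"
  unfolding s_term_eq using e_step[of n] by (auto simp: w_Suc_step algebra_simps)

text \<open>Since \<open>w 0 = 1\<close>, the numerator \<open>1 + m * s\<close> is the weight of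
  index 0 together with the indices just after a jump of \<open>e\<close>, hence a part of the total
  weight \<open>T\<close>.\<close>

lemma numer_sum: "m * s = (\<Sum>n. w (Suc n) * of_int (e (Suc n) - e n))"
  unfolding s_def numer_term by (simp only: suminf_mult[OF summable_s])

definition D :: real where "D = (1 - l) * (1 + m * s) / (1 + (m - 1) * s)"

lemma D_eq: "D = (1 + m * s) / T"
  using l T_pos by (simp add: D_def denom_eq)

text \<open>For \<open>\<delta> = D\<close> the left side is the length of the gap between the limit
  of the map at 1 and its value at 0; it is the first normalised weight
  \<open>w 0 / T\<close>.\<close>

lemma gap_eq: "D - m * (l + D - 1) = 1 / T"
proof -
  have "T * (D - m * (l + D - 1)) = (1 - m) * (T * D) + m * ((1 - l) * T)"
    by (simp add: algebra_simps)
  also have "\<dots> = (1 - m) * (1 + m * s) + m * (1 + (m - 1) * s)"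
    using T_pos by (simp add: D_eq flip: denom_eq)
  also have "\<dots> = 1" by (simp add: algebra_simps)
  finally show ?thesis using T_pos by (simp add: field_simps)
qed

text \<open>A single jump of \<open>e\<close> makes \<open>s\<close> positive, and the numerator in
  \<open>D\<close> exceeds the denominator by exactly \<open>s\<close>.\<close>

lemma D_greater:
  assumes "e (Suc n) \<noteq> e n" shows "1 - l < D"
proof -
  have "0 < s" unfolding s_def
  proof (rule suminf_pos2[OF summable_s])
    show "0 < of_int (e (Suc n) - e n) * l ^ Suc n * m powi e n"
      using assms e_step[of n] l m by auto
    show "0 \<le> of_int (e (Suc k) - e k) * l ^ Suc k * m powi e k" for k
      using e_step[of k] l m by auto
  qed
  then have "1 + (m - 1) * s < 1 + m * s" by (simp add: left_diff_distrib)
  moreover have "0 < 1 + (m - 1) * s" using l T_pos by (simp add: denom_eq)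
  ultimately show ?thesis using l unfolding D_def by (simp add: less_divide_eq)
qed

text \<open>The difference \<open>T - (1 + m * s)\<close> is the weight of the positive indices that
  do not follow a jump, so one constant step of \<open>e\<close> makes it positive.\<close>

lemma D_less_one:
  assumes "e (Suc n) = e n" shows "D < 1"
proof -
  have "0 < (\<Sum>k. w (Suc k) * (1 - of_int (e (Suc k) - e k)))"
  proof (rule suminf_pos2)
    show "summable (\<lambda>k. w (Suc k) * (1 - of_int (e (Suc k) - e k)))"
    proof (rule summable_comparison_test'[where N = 0])
      show "summable (\<lambda>k. w (Suc k))" using summable_w by (simp add: summable_Suc_iff)
      show "norm (w (Suc k) * (1 - of_int (e (Suc k) - e k))) \<le> w (Suc k)" for k
        using e_step[of k] w_pos[of "Suc k"] by auto
    qed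
    show "0 < w (Suc n) * (1 - of_int (e (Suc n) - e n))" using assms w_pos by simp
    show "0 \<le> w (Suc k) * (1 - of_int (e (Suc k) - e k))" for k
      using e_step[of k] w_pos[of "Suc k"] by auto
  qed
  also have "\<dots> = (\<Sum>k. w (Suc k) - w (Suc k) * of_int (e (Suc k) - e k))"
    by (simp add: algebra_simps)
  also have "\<dots> = (T - 1) - m * s"
  proof (subst suminf_diff[symmetric])
    show "summable (\<lambda>k. w (Suc k) * of_int (e (Suc k) - e k))"
      unfolding numer_term by (intro summable_mult summable_s)
    show "summable (\<lambda>k. w (Suc k))" using summable_w by (simp add: summable_Suc_iff)
  qed (simp only: T_shift numer_sum)
  finally show ?thesis using T_pos by (simp add: D_eq)
qed

text \<open>In the case \<open>l * m \<ge> 1\<close> the bound is a rearrangement of the positivity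
  of the gap.\<close>

lemma D_less_d_bound:
  assumes "e (Suc n) = e n" shows "D < d_bound l m"
proof (cases "l * m < 1")
  case True
  then show ?thesis using D_less_one[OF assms] by (simp add: d_bound_def)
next
  case False
  then have "m > 1" using l by (intro one_less_of_one_le_mult)
  moreover have "0 < D - m * (l + D - 1)" using T_pos by (simp add: gap_eq)
  ultimately show ?thesis using False by (simp add: d_bound_def field_simps)
qed

text \<open>Shifting the index by a period multiplies every term by \<open>l ^ q * m ^ p\<close>, so
  the series is geometric in blocks of length \<open>q\<close>.\<close>

lemma s_periodic:
  assumes per: "\<And>n. e (n + q) = e n + int p" and q: "q > 0" and small: "l ^ q * m ^ p < 1"
  shows "s = (\<Sum>n<q. of_int (e (Suc n) - e n) * l ^ Suc n * m powi e n) / (1 - l ^ q * m ^ p)"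
proof -
  define t where "t n = of_int (e (Suc n) - e n) * l ^ Suc n * m powi e n" for n
  have t: "summable t" unfolding t_def using summable_s .
  have "t (n + q) = l ^ q * m ^ p * t n" for n
    using m per[of n] per[of "Suc n"] by (simp add: t_def power_int_add power_add mult_ac)
  then have "(\<Sum>n. t (n + q)) = l ^ q * m ^ p * (\<Sum>n. t n)"
    using suminf_mult[OF t] by simp
  then have "(\<Sum>n. t n) = l ^ q * m ^ p * (\<Sum>n. t n) + (\<Sum>n<q. t n)"
    using suminf_split_initial_segment[OF t, of q] by simp
  then have "s * (1 - l ^ q * m ^ p) = (\<Sum>n<q. t n)"
    unfolding s_def t_def by (simp add: algebra_simps)
  then show ?thesis using small by (simp add: t_def eq_divide_eq)
qed

end

section \<open>Floor exponents and the range of \<open>delta\<close>\<close>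

lemma sigma_eq:
  "sigma l m r = (\<Sum>n. of_int (\<lfloor>real (Suc (Suc n)) * r\<rfloor> - \<lfloor>real (Suc n) * r\<rfloor>) * l ^ Suc n
     * m powi \<lfloor>real (Suc n) * r\<rfloor>)"
  by (simp add: sigma_def Let_def)

lemma floor_add_step:
  fixes a r :: real
  assumes "0 \<le> r" "r < 1"
  shows "\<lfloor>a + r\<rfloor> = \<lfloor>a\<rfloor> \<or> \<lfloor>a + r\<rfloor> = \<lfloor>a\<rfloor> + 1"
  using assms by linarith

text \<open>The rate \<open>R\<close> may exceed \<open>r\<close>, which lets all parameters below
  \<open>R\<close> share the majorant of rate \<open>R\<close> when limits in \<open>r\<close> are
  taken.\<close>

lemma exponents_floor:
  assumes "0 < l" "l < 1" "0 < m" "0 < r" "r \<le> R" "R < r_bound l m"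
  shows "exponents l m R (\<lambda>n. \<lfloor>real (Suc n) * r\<rfloor>)"
proof
  have r1: "r < 1" using r_bound_le_one[OF assms(1-3)] assms by simp
  show "0 < R" using assms by simp
  then show "l * m powr R < 1" using assms by (intro mult_powr_less_one)
  show "\<lfloor>real (Suc 0) * r\<rfloor> = 0" using assms r1 by (simp add: floor_eq_iff)
  show "\<lfloor>real (Suc (Suc n)) * r\<rfloor> = \<lfloor>real (Suc n) * r\<rfloor>
      \<or> \<lfloor>real (Suc (Suc n)) * r\<rfloor> = \<lfloor>real (Suc n) * r\<rfloor> + 1" for n
  proof -
    have "real (Suc (Suc n)) * r = real (Suc n) * r + r" by (simp add: algebra_simps)
    then show ?thesis using floor_add_step[of r "real (Suc n) * r"] assms r1 by simp
  qed
  show "of_int \<lfloor>real (Suc n) * r\<rfloor> \<le> real (Suc n) * R" for n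
    using mult_left_mono[of r R "real (Suc n)"] assms by linarith
qed (use assms in auto)

lemma floor_multiple_unbounded:
  fixes r :: real
  assumes "r > 0" shows "\<exists>n. \<lfloor>real (Suc (Suc n)) * r\<rfloor> \<noteq> \<lfloor>real (Suc n) * r\<rfloor>"
proof (rule ccontr)
  assume "\<not> ?thesis"
  then have const: "\<lfloor>real (Suc n) * r\<rfloor> = \<lfloor>real (Suc 0) * r\<rfloor>" for n
    by (induction n) auto
  obtain N where "1 / r + 2 < real N" using reals_Archimedean2 by blast
  then have "2 * r + 1 < real (Suc N) * r" using assms by (simp add: field_simps)
  moreover have "real (Suc 0) * r = r" by simp
  ultimately show False using const[of N] assms by linarith
qed

text \<open>If every step were a jump, the floors would grow at rate one, faster than the multiples
  of \<open>r\<close>. The constant step found here is what \<open>D_less_d_bound\<close> asks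
  for.\<close>

lemma floor_multiple_sublinear:
  fixes r :: real
  assumes "r < 1" shows "\<exists>n. \<lfloor>real (Suc (Suc n)) * r\<rfloor> \<noteq> \<lfloor>real (Suc n) * r\<rfloor> + 1"
proof (rule ccontr)
  assume "\<not> ?thesis"
  then have lin: "\<lfloor>real (Suc n) * r\<rfloor> = \<lfloor>real (Suc 0) * r\<rfloor> + int n" for n
    by (induction n) auto
  obtain N where "1 / (1 - r) < real N" using reals_Archimedean2 by blast
  then have "1 < real N * (1 - r)" using assms by (simp add: field_simps)
  then have "real (Suc N) * r < real N - 1 + r" by (simp add: algebra_simps)
  moreover have "real (Suc 0) * r = r" by simp
  ultimately show False using lin[of N] by linarith
qed

lemma delta_eq_D:
  assumes "exponents l m r (\<lambda>n. \<lfloor>real (Suc n) * r\<rfloor>)"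
  shows "delta l m r = exponents.D l m (\<lambda>n. \<lfloor>real (Suc n) * r\<rfloor>)"
  by (simp only: delta_def sigma_eq exponents.D_def[OF assms] exponents.s_def[OF assms])

lemma delta_in_range:
  assumes "exponents l m r (\<lambda>n. \<lfloor>real (Suc n) * r\<rfloor>)" "r < 1"
  shows "1 - l < delta l m r" "delta l m r < d_bound l m"
proof -
  interpret exponents l m r "\<lambda>n. \<lfloor>real (Suc n) * r\<rfloor>" by fact
  obtain n where "\<lfloor>real (Suc (Suc n)) * r\<rfloor> \<noteq> \<lfloor>real (Suc n) * r\<rfloor>"
    using floor_multiple_unbounded[OF r] by blast
  then show "1 - l < delta l m r" unfolding delta_eq_D[OF assms(1)] by (rule D_greater)
  obtain n where "\<lfloor>real (Suc (Suc n)) * r\<rfloor> \<noteq> \<lfloor>real (Suc n) * r\<rfloor> + 1"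
    using floor_multiple_sublinear[OF assms(2)] by blast
  then have "\<lfloor>real (Suc (Suc n)) * r\<rfloor> = \<lfloor>real (Suc n) * r\<rfloor>" using e_step[of n] by blast
  then show "delta l m r < d_bound l m" unfolding delta_eq_D[OF assms(1)] by (rule D_less_d_bound)
qed

subsection \<open>Semiconjugacy to an irrational rotation\<close>

locale irrational_rotation = exponents +
  assumes e_floor: "e n = \<lfloor>real (Suc n) * r\<rfloor>" and r1: "r < 1" and irr: "r \<notin> \<rat>"
begin

lemma e_eq: "e = (\<lambda>n. \<lfloor>real (Suc n) * r\<rfloor>)"
  using e_floor by blast

lemma delta_eq: "delta l m r = D"
  using delta_eq_D exponents_axioms unfolding e_eq by blast

lemma delta_range: "1 - l < delta l m r" "delta l m r < d_bound l m"
  using delta_in_range exponents_axioms r1 unfolding e_eq by blast+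

lemma multiple_not_int: "real (Suc n) * r \<noteq> of_int i"
proof
  assume "real (Suc n) * r = of_int i"
  then have "r = of_int i / of_nat (Suc n)" by (simp add: field_simps)
  then show False using irr by (metis Rats_divide Rats_of_int Rats_of_nat)
qed

lemma floor_minus_multiple: "\<lfloor>- (real (Suc n) * r)\<rfloor> = - e n - 1"
  using multiple_not_int[of n "e n"] e_floor[of n] by linarith

text \<open>For \<open>y \<ge> 0\<close> this counts the points congruent to
  \<open>(n + 1) * r\<close> modulo 1 in the interval from 0 (excluded) to \<open>y\<close>
  (included).\<close>

definition d :: "nat \<Rightarrow> real \<Rightarrow> int" where
  "d n y = \<lfloor>y - real (Suc n) * r\<rfloor> - \<lfloor>- (real (Suc n) * r)\<rfloor>"

text \<open>The jump function before normalisation: the semiconjugacy is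
  \<open>P y / T\<close>.\<close>

definition P :: "real \<Rightarrow> real" where "P y = (\<Sum>n. w n * of_int (d n y))"

lemma summable_P: "summable (\<lambda>n. w n * of_int (d n y))"
proof (rule summable_w_bounded)
  show "\<bar>real_of_int (d n y)\<bar> \<le> \<bar>y\<bar> + 1" for n
    unfolding d_def by linarith
qed

lemma P_0: "P 0 = 0"
  by (simp add: P_def d_def)

lemma P_mono: "x \<le> y \<Longrightarrow> P x \<le> P y"
  unfolding P_def
  by (intro suminf_le summable_P mult_left_mono less_imp_le[OF w_pos])
    (auto simp: d_def intro: floor_mono)

lemma P_add_int: "P (y + of_int i) = P y + of_int i * T"
proof -
  have "d n (y + of_int i) = d n y + i" for n
    unfolding d_def using floor_add_int[of "y - real (Suc n) * r" i] by (simp add: algebra_simps)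
  then have "w n * of_int (d n (y + of_int i)) = w n * of_int (d n y) + of_int i * w n" for n
    by (simp add: algebra_simps)
  then show ?thesis
    unfolding P_def T_def
    using suminf_add[OF summable_P summable_mult[OF summable_w], of y "of_int i"]
      suminf_mult[OF summable_w, of "of_int i"] by simp
qed

lemma d_bounds:
  assumes "0 \<le> y" "y < 1" shows "d n y = 0 \<or> d n y = 1"
  unfolding d_def using assms floor_minus_multiple[of n] e_floor[of n] by linarith

text \<open>Moving \<open>(n + 2) * r\<close> back by \<open>r\<close> gives
  \<open>(n + 1) * r\<close>. Hence, modulo 1, the former lies between 0 and \<open>r\<close>
  exactly when the floor jumps from \<open>n\<close> to \<open>Suc n\<close>.\<close>

lemma d_rotate: "d (Suc n) r = e (Suc n) - e n"
proof -
  have "r - real (Suc (Suc n)) * r = - (real (Suc n) * r)" by (simp add: algebra_simps)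
  then show ?thesis by (simp only: d_def floor_minus_multiple)
qed

lemma d_0: assumes "0 \<le> y" "y < 1" shows "d 0 (y + r) = 1"
proof -
  have "y + r - real (Suc 0) * r = y" "\<lfloor>y\<rfloor> = 0" using assms by (simp_all add: floor_eq_iff)
  then show ?thesis unfolding d_def floor_minus_multiple using e_0 by simp
qed

text \<open>The jumps up to \<open>r\<close> are those of index 0 and of the indices after a jump of
  \<open>e\<close>. By \<open>D_eq\<close> this gives \<open>P r / T = D\<close>, the value that the
  lift must take at 0.\<close>

lemma P_r: "P r = 1 + m * s"
proof -
  have "P r = w 0 * of_int (d 0 r) + (\<Sum>n. w (Suc n) * of_int (d (Suc n) r))"
    unfolding P_def using suminf_split_head[OF summable_P[of r]] by simp
  also have "\<dots> = 1 + m * s"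
    using d_0[of 0] e_0 by (simp only: d_rotate numer_sum) (simp add: w_def e_0)
  finally show ?thesis .
qed

lemma summable_P_Suc: "summable (\<lambda>n. w (Suc n) * of_int (d n y))"
proof (rule summable_comparison_test'[where N = 0])
  show "summable (\<lambda>n. w (Suc n) * (\<bar>y\<bar> + 1))"
    using summable_w by (intro summable_mult2) (simp add: summable_Suc_iff)
  have "\<bar>real_of_int (d n y)\<bar> \<le> \<bar>y\<bar> + 1" for n
    unfolding d_def by linarith
  then show "norm (w (Suc n) * of_int (d n y)) \<le> w (Suc n) * (\<bar>y\<bar> + 1)" for n
    using w_pos[of "Suc n"] by (simp add: abs_mult)
qed

text \<open>Rotation by \<open>r\<close> carries the jump points of index \<open>n\<close> to those
  of index \<open>Suc n\<close>, so the jumps between \<open>r\<close> and \<open>y + r\<close> have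
  the weights \<open>w (Suc n)\<close>. Index 0 contributes equally to \<open>P (y + r)\<close> and
  \<open>P r\<close>.\<close>

lemma P_rotate:
  assumes "0 \<le> y" "y < 1"
  shows "P (y + r) = P r + (\<Sum>n. w (Suc n) * of_int (d n y))"
proof -
  have "d (Suc n) (y + r) = d (Suc n) r + d n y" for n
  proof -
    have "y + r - real (Suc (Suc n)) * r = y - real (Suc n) * r"
      "r - real (Suc (Suc n)) * r = - (real (Suc n) * r)" by (simp_all add: algebra_simps)
    then show ?thesis by (simp only: d_def)
  qed
  then have eq: "w (Suc n) * of_int (d (Suc n) (y + r))
      = w (Suc n) * of_int (d (Suc n) r) + w (Suc n) * of_int (d n y)" for n
    by (simp add: algebra_simps)
  have sr: "summable (\<lambda>n. w (Suc n) * of_int (d (Suc n) r))"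
    using summable_P[of r] by (simp only: summable_Suc_iff[of "\<lambda>n. w n * of_int (d n r)"])
  have "P (y + r) = w 0 * of_int (d 0 (y + r)) + (\<Sum>n. w (Suc n) * of_int (d (Suc n) (y + r)))"
    unfolding P_def using suminf_split_head[OF summable_P[of "y + r"]] by simp
  also have "\<dots> = w 0 * of_int (d 0 r) + (\<Sum>n. w (Suc n) * of_int (d (Suc n) r))
      + (\<Sum>n. w (Suc n) * of_int (d n y))"
    using d_0[OF assms] d_0[of 0] suminf_add[OF sr summable_P_Suc[of y]] by (simp only: eq) simp
  also have "\<dots> = P r + (\<Sum>n. w (Suc n) * of_int (d n y))"
    unfolding P_def using suminf_split_head[OF summable_P[of r]] by simp
  finally show ?thesis .
qed

text \<open>Where \<open>e\<close> jumps after \<open>n\<close>, the fractional part of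
  \<open>(n + 1) * r\<close> is at least \<open>1 - r\<close> and so beyond \<open>y\<close>. Every
  index that counts has \<open>w (Suc n) = l * w n\<close>, which is the slope of the first
  branch.\<close>

lemma P_rotate_left:
  assumes "0 \<le> y" "y < 1 - r"
  shows "P (y + r) = P r + l * P y"
proof -
  have "w (Suc n) * of_int (d n y) = l * (w n * of_int (d n y))" for n
  proof (cases "e (Suc n) = e n")
    case True
    then show ?thesis using w_Suc_same[of n] by simp
  next
    case False
    then have "e (Suc n) = e n + 1" using e_step[of n] by simp
    moreover have "real (Suc (Suc n)) * r = real (Suc n) * r + r" by (simp add: algebra_simps)
    ultimately have "d n y = 0"
      unfolding d_def floor_minus_multiple using assms multiple_not_int[of n "e n"]
        e_floor[of n] e_floor[of "Suc n"]
      by linarith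
    then show ?thesis by simp
  qed
  then have "(\<Sum>n. w (Suc n) * of_int (d n y)) = l * P y"
    unfolding P_def by (simp only: suminf_mult[OF summable_P])
  then show ?thesis using P_rotate[of y] assms r by simp
qed

text \<open>The complement \<open>T - P y\<close> collects jumps beyond \<open>1 - r\<close>. There
  \<open>e\<close> jumps, so those weights scale by \<open>l * m\<close>, the slope of the second
  branch.\<close>

lemma P_rotate_right:
  assumes "1 - r \<le> y" "y < 1"
  shows "P (y + r) = P r + (T - 1) - l * m * (T - P y)"
proof -
  have y: "0 \<le> y" using assms r1 by simp
  have "w (Suc n) - w (Suc n) * of_int (d n y) = l * m * (w n - w n * of_int (d n y))" for n
  proof (cases "e (Suc n) = e n + 1")
    case True
    then show ?thesis using w_Suc_step[of n] by (simp add: algebra_simps)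
  next
    case False
    then have "e (Suc n) = e n" using e_step[of n] by simp
    moreover have "real (Suc (Suc n)) * r = real (Suc n) * r + r" by (simp add: algebra_simps)
    ultimately have "d n y = 1"
      unfolding d_def floor_minus_multiple using assms multiple_not_int[of n "e n"]
        e_floor[of n] e_floor[of "Suc n"]
      by linarith
    then show ?thesis by simp
  qed
  then have "(\<Sum>n. w (Suc n) - w (Suc n) * of_int (d n y)) = l * m * (\<Sum>n. w n - w n * of_int (d n y))"
    by (simp add: suminf_mult summable_diff summable_w summable_P)
  moreover have "(\<Sum>n. w n - w n * of_int (d n y)) = T - P y"
    unfolding T_def P_def by (rule suminf_diff[OF summable_w summable_P, symmetric])
  moreover have "(\<Sum>n. w (Suc n) - w (Suc n) * of_int (d n y))
      = (T - 1) - (\<Sum>n. w (Suc n) * of_int (d n y))"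
    using suminf_diff[of "\<lambda>n. w (Suc n)", OF _ summable_P_Suc[of y]] summable_w
    by (simp only: T_shift summable_Suc_iff)
  ultimately show ?thesis using P_rotate[OF y assms(2)] by simp
qed

text \<open>Density of the orbit of the irrational rotation puts a jump of \<open>P\<close> into \<open>{y<..<1}\<close>.\<close>

lemma P_less:
  assumes "0 \<le> y" "y < 1" shows "P y < T"
proof -
  obtain k where k: "k > 0" "\<bar>frac (real k * r) - (1 + y) / 2\<bar> < (1 - y) / 2"
    using Kronecker_approx_1_explicit[OF irr, of "(1 + y) / 2" "(1 - y) / 2"] assms by auto
  obtain n where n: "k = Suc n" using k gr0_conv_Suc by blast
  have "y < frac (real (Suc n) * r)" using k n by (auto simp: abs_if field_simps split: if_splits)
  then have "d n y = 0"
    unfolding d_def floor_minus_multiple using assms e_floor[of n] by (simp only: frac_def) linarith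
  have "0 < (\<Sum>n. w n - w n * of_int (d n y))"
  proof (rule suminf_pos2)
    show "0 < w n - w n * of_int (d n y)" using w_pos \<open>d n y = 0\<close> by simp
    show "0 \<le> w k - w k * of_int (d k y)" for k
      using d_bounds[OF assms, of k] w_pos[of k] by auto
  qed (intro summable_diff summable_w summable_P)
  also have "\<dots> = T - P y"
    unfolding T_def P_def by (rule suminf_diff[OF summable_w summable_P, symmetric])
  finally show ?thesis by simp
qed

text \<open>The branch is decided by the value reached: \<open>P (y + r) / T\<close> is below 1 for
  \<open>y + r < 1\<close> by \<open>P_less\<close>, and at least 1 otherwise by monotonicity. So
  the break of the lift corresponds to \<open>y = 1 - r\<close>.\<close>

lemma F_lift_semiconj_unit:
  assumes "0 \<le> y" "y < 1"
  shows "F_lift l m (delta l m r) (P y / T) = P (y + r) / T"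
proof -
  have "0 \<le> P y / T" "P y / T < 1"
    using P_mono[OF assms(1)] P_less[OF assms] T_pos by (simp_all add: P_0)
  then have fl: "\<lfloor>P y / T\<rfloor> = 0" and fr: "frac (P y / T) = P y / T"
    by (auto simp: floor_eq_iff frac_eq)
  have F: "F_lift l m (delta l m r) (P y / T) = fold_up m (l * (P y / T) + D)"
    using l by (simp add: F_lift_eq_fold_up fl fr delta_eq)
  have PD: "P r / T = D" by (simp add: P_r D_eq)
  show ?thesis
  proof (cases "y < 1 - r")
    case True
    have "P (y + r) / T = l * (P y / T) + D"
      using P_rotate_left[OF assms(1) True] PD by (simp add: add_divide_distrib)
    moreover have "P (y + r) / T < 1"
      using P_less[of "y + r"] True assms r T_pos by simp
    ultimately show ?thesis by (simp add: F fold_up_def)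
  next
    case False
    have "P (y + r) / T = D + 1 - 1 / T - l * m * (1 - P y / T)"
      using P_rotate_right[of y] False assms T_pos
      by (simp flip: PD) (simp add: field_simps)
    \<comment> \<open>Replacing \<open>1 / T\<close> by the gap length turns the rotated jump
      function into the second branch.\<close>
    also have "\<dots> = 1 + m * (l * (P y / T) + D - 1)"
      by (simp only: gap_eq[symmetric]) (simp add: algebra_simps)
    finally have eq: "P (y + r) / T = 1 + m * (l * (P y / T) + D - 1)" .
    have "P (0 + of_int 1) \<le> P (y + r)" using False by (intro P_mono) simp
    then have "1 \<le> P (y + r) / T"
      using T_pos by (simp only: P_add_int P_0) (simp add: le_divide_eq)
    then have "0 \<le> l * (P y / T) + D - 1"
      unfolding eq using m by (simp add: zero_le_mult_iff)
    then show ?thesis unfolding F eq by (simp add: fold_up_def)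
  qed
qed

lemma degree_one: "degree_one (F_lift l m (delta l m r))"
  using l m delta_range by (intro degree_one_F_lift)

lemma F_lift_semiconj: "F_lift l m (delta l m r) (P y / T) = P (y + r) / T"
proof -
  have P: "P (z + of_int \<lfloor>y\<rfloor>) / T = P z / T + of_int \<lfloor>y\<rfloor>" for z
    using T_pos by (simp add: P_add_int add_divide_distrib)
  have "P y / T = P (frac y) / T + of_int \<lfloor>y\<rfloor>" "P (y + r) / T = P (frac y + r) / T + of_int \<lfloor>y\<rfloor>"
    using P[of "frac y"] P[of "frac y + r"] by (simp_all add: frac_def algebra_simps)
  then show ?thesis
    using F_lift_semiconj_unit[of "frac y"] by (simp add: frac_lt_1 degree_one_add_int[OF degree_one])
qed

lemma rho_delta: "rho l m (delta l m r) = r"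
  unfolding rho_def
proof (rule rotation_number_semiconj[where \<phi> = "\<lambda>y. P y / T" and c = 1, OF degree_one _ F_lift_semiconj])
  fix y
  have "P (0 + of_int \<lfloor>y\<rfloor>) \<le> P y" "P y \<le> P (0 + of_int (\<lfloor>y\<rfloor> + 1))"
    by (intro P_mono; linarith)+
  then have "of_int \<lfloor>y\<rfloor> \<le> P y / T" "P y / T \<le> of_int (\<lfloor>y\<rfloor> + 1)"
    using T_pos by (simp_all only: P_add_int P_0) (simp_all add: field_simps)
  then show "\<bar>P y / T - y\<bar> \<le> 1" by linarith
qed

end

subsection \<open>One-sided limits\<close>

lemma exponents_ceiling:
  assumes "0 < l" "l < 1" "0 < m" "0 < r" "r < r_bound l m"
  shows "exponents l m r (\<lambda>n. \<lceil>real (Suc n) * r\<rceil> - 1)"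
proof
  have r1: "r < 1" using r_bound_le_one[OF assms(1-3)] assms by simp
  show "l * m powr r < 1" using assms by (rule mult_powr_less_one)
  show "\<lceil>real (Suc 0) * r\<rceil> - 1 = 0" using assms r1 by (simp add: ceiling_eq_iff)
  show "\<lceil>real (Suc (Suc n)) * r\<rceil> - 1 = \<lceil>real (Suc n) * r\<rceil> - 1
      \<or> \<lceil>real (Suc (Suc n)) * r\<rceil> - 1 = \<lceil>real (Suc n) * r\<rceil> - 1 + 1" for n
  proof -
    have "real (Suc (Suc n)) * r = real (Suc n) * r + r" by (simp add: algebra_simps)
    then show ?thesis using assms r1 by linarith
  qed
  show "of_int (\<lceil>real (Suc n) * r\<rceil> - 1) \<le> real (Suc n) * r" for n
    by linarith
qed (use assms in auto)

text \<open>Tannery's theorem applies: each term of \<open>sigma\<close> is eventually constant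
  along the filter, and the majorant of rate \<open>R\<close> is uniform in the parameter. A general
  filter treats both one-sided limits at once.\<close>

lemma delta_tendsto:
  assumes "0 < l" "l < 1" "0 < m" and R: "R < r_bound l m"
    and e: "exponents l m R e" and F: "F \<noteq> bot"
    and range: "\<forall>\<^sub>F r in F. 0 < r \<and> r < R"
    and floors: "\<And>n. \<forall>\<^sub>F r in F. \<lfloor>real (Suc n) * r\<rfloor> = e n"
  shows "(delta l m \<longlongrightarrow> exponents.D l m e) F"
proof -
  interpret exponents l m R e by fact
  have "((\<lambda>r. sigma l m r) \<longlongrightarrow> s) F"
    unfolding sigma_eq s_def
  proof (rule tannerys_theorem[THEN conjunct2, THEN conjunct2])
    show "((\<lambda>r. of_int (\<lfloor>real (Suc (Suc n)) * r\<rfloor> - \<lfloor>real (Suc n) * r\<rfloor>) * l ^ Suc n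
        * m powi \<lfloor>real (Suc n) * r\<rfloor>) \<longlongrightarrow> of_int (e (Suc n) - e n) * l ^ Suc n * m powi e n) F" for n
    proof (rule tendsto_eventually)
      show "\<forall>\<^sub>F r in F. of_int (\<lfloor>real (Suc (Suc n)) * r\<rfloor> - \<lfloor>real (Suc n) * r\<rfloor>) * l ^ Suc n
        * m powi \<lfloor>real (Suc n) * r\<rfloor> = of_int (e (Suc n) - e n) * l ^ Suc n * m powi e n"
        using floors[of n] floors[of "Suc n"] by eventually_elim (simp only:)
    qed
    show "summable (\<lambda>n. \<theta> ^ Suc n)" by (rule summable_theta)
    have "norm (of_int (\<lfloor>real (Suc (Suc n)) * r\<rfloor> - \<lfloor>real (Suc n) * r\<rfloor>) * l ^ Suc n
        * m powi \<lfloor>real (Suc n) * r\<rfloor>) \<le> \<theta> ^ Suc n" if r: "0 < r" "r < R" for r n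
    proof -
      interpret fl: exponents l m R "\<lambda>n. \<lfloor>real (Suc n) * r\<rfloor>"
        using assms(1-3) r R by (intro exponents_floor) auto
      have "\<bar>real_of_int (\<lfloor>real (Suc (Suc n)) * r\<rfloor> - \<lfloor>real (Suc n) * r\<rfloor>)\<bar>
          * (l ^ Suc n * m powi \<lfloor>real (Suc n) * r\<rfloor>) \<le> 1 * \<theta> ^ Suc n"
        using assms(1,3) by (intro mult_mono fl.step_bounded fl.term_bound) auto
      then show ?thesis using assms(1,3) by (simp only: norm_mult real_norm_def) (simp add: abs_mult mult_ac)
    qed
    then have "\<forall>\<^sub>F r in F. \<forall>n. norm (of_int (\<lfloor>real (Suc (Suc n)) * r\<rfloor> - \<lfloor>real (Suc n) * r\<rfloor>) * l ^ Suc n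
        * m powi \<lfloor>real (Suc n) * r\<rfloor>) \<le> \<theta> ^ Suc n"
      using range by (auto elim: eventually_mono)
    then show "\<forall>\<^sub>F (n, r) in sequentially \<times>\<^sub>F F. norm (of_int (\<lfloor>real (Suc (Suc n)) * r\<rfloor> - \<lfloor>real (Suc n) * r\<rfloor>) * l ^ Suc n
        * m powi \<lfloor>real (Suc n) * r\<rfloor>) \<le> \<theta> ^ Suc n"
      unfolding eventually_prod_filter
      by (intro exI[of _ "\<lambda>_. True"] exI conjI, simp, assumption) simp
  qed (rule F)
  \<comment> \<open>The denominator tends to \<open>(1 - l) * T\<close>, which is positive.\<close>
  moreover have "1 + (m - 1) * s \<noteq> 0" using assms(2) T_pos by (simp add: denom_eq)
  ultimately show ?thesis unfolding delta_def D_def by (intro tendsto_intros)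
qed

lemma eventually_floor_at_left:
  fixes r0 :: real
  shows "\<forall>\<^sub>F r in at_left r0. \<lfloor>real (Suc n) * r\<rfloor> = \<lceil>real (Suc n) * r0\<rceil> - 1"
  unfolding eventually_at_left_field
proof (intro exI conjI allI impI)
  \<comment> \<open>The largest multiple of \<open>1 / (n + 1)\<close> strictly below
    \<open>r0\<close>; the floor is constant from there up to \<open>r0\<close>.\<close>
  define b where "b = of_int (\<lceil>real (Suc n) * r0\<rceil> - 1) / real (Suc n)"
  have b: "real (Suc n) * b = of_int (\<lceil>real (Suc n) * r0\<rceil> - 1)" by (simp add: b_def)
  then have "real (Suc n) * b < real (Suc n) * r0" by linarith
  then show "b < r0" by simp
  fix r assume "b < r" "r < r0"
  then have "real (Suc n) * b < real (Suc n) * r" "real (Suc n) * r < real (Suc n) * r0"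
    by (simp_all only: mult_less_cancel_left_pos of_nat_0_less_iff zero_less_Suc)
  with b show "\<lfloor>real (Suc n) * r\<rfloor> = \<lceil>real (Suc n) * r0\<rceil> - 1" by linarith
qed

lemma eventually_floor_at_right:
  fixes r0 :: real
  shows "\<forall>\<^sub>F r in at_right r0. \<lfloor>real (Suc n) * r\<rfloor> = \<lfloor>real (Suc n) * r0\<rfloor>"
  unfolding eventually_at_right_field
proof (intro exI conjI allI impI)
  \<comment> \<open>The smallest multiple of \<open>1 / (n + 1)\<close> strictly above
    \<open>r0\<close>.\<close>
  define b where "b = of_int (\<lfloor>real (Suc n) * r0\<rfloor> + 1) / real (Suc n)"
  have b: "real (Suc n) * b = of_int (\<lfloor>real (Suc n) * r0\<rfloor> + 1)" by (simp add: b_def)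
  then have "real (Suc n) * r0 < real (Suc n) * b" by linarith
  then show "r0 < b" by simp
  fix r assume "r0 < r" "r < b"
  then have "real (Suc n) * r0 < real (Suc n) * r" "real (Suc n) * r < real (Suc n) * b"
    by (simp_all only: mult_less_cancel_left_pos of_nat_0_less_iff zero_less_Suc)
  with b show "\<lfloor>real (Suc n) * r\<rfloor> = \<lfloor>real (Suc n) * r0\<rfloor>" by linarith
qed

lemma irrational_between:
  fixes a b :: real
  assumes "a < b" obtains x where "a < x" "x < b" "x \<notin> \<rat>"
proof -
  have "uncountable {a<..<b}" using assms by (simp add: uncountable_open_interval)
  then have "\<not> {a<..<b} \<subseteq> \<rat>" using countable_rat countable_subset by blast
  then show ?thesis using that by force
qed

subsection \<open>The level sets of the rotation number\<close>

locale rotation_family =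
  fixes l m :: real
  assumes l: "0 < l" "l < 1" and m: "0 < m"
begin

definition left_limit :: "real \<Rightarrow> real" where
  "left_limit r = exponents.D l m (\<lambda>n. \<lceil>real (Suc n) * r\<rceil> - 1)"

lemma tendsto_left:
  assumes "0 < r0" "r0 < r_bound l m"
  shows "(delta l m \<longlongrightarrow> left_limit r0) (at_left r0)"
  unfolding left_limit_def using assms l m
  by (intro delta_tendsto[of l m r0] exponents_ceiling eventually_floor_at_left)
    (auto simp: eventually_at_left_field intro!: exI[of _ 0])

lemma tendsto_right:
  assumes "0 < r0" "r0 < r_bound l m"
  shows "(delta l m \<longlongrightarrow> delta l m r0) (at_right r0)"
proof -
  \<comment> \<open>Parameters to the right of \<open>r0\<close> require a majorant of larger rate.
    The value \<open>D\<close> depends on the exponents only and not on that rate, so the limit is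
    still \<open>delta l m r0\<close>.\<close>
  obtain R where R: "r0 < R" "R < r_bound l m" using assms dense by blast
  have "exponents l m r0 (\<lambda>n. \<lfloor>real (Suc n) * r0\<rfloor>)" "exponents l m R (\<lambda>n. \<lfloor>real (Suc n) * r0\<rfloor>)"
    using assms R l m by (auto simp del: of_nat_Suc intro!: exponents_floor)
  moreover have "\<forall>\<^sub>F r in at_right r0. 0 < r \<and> r < R"
    using R assms by (auto simp: eventually_at_right_field intro!: exI[of _ R])
  ultimately show ?thesis
    using l m R eventually_floor_at_right by (simp only: delta_eq_D) (intro delta_tendsto, auto)
qed

lemma delta_left_eq:
  assumes "0 < r0" "r0 < r_bound l m" shows "delta_left l m r0 = left_limit r0"
  unfolding delta_left_def using tendsto_Lim[OF _ tendsto_left[OF assms]] by simp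

lemma delta_bounds:
  assumes "0 < r" "r < r_bound l m" shows "1 - l < delta l m r" "delta l m r < d_bound l m"
  using delta_in_range exponents_floor[OF l m assms(1) order_refl assms(2)] r_bound_le_one[OF l m]
    assms by fastforce+

lemma rho_delta_irrational:
  assumes "0 < r" "r < r_bound l m" "r \<notin> \<rat>" shows "rho l m (delta l m r) = r"
proof -
  interpret exponents l m r "\<lambda>n. \<lfloor>real (Suc n) * r\<rfloor>"
    using l m assms by (intro exponents_floor) auto
  interpret irrational_rotation l m r "\<lambda>n. \<lfloor>real (Suc n) * r\<rfloor>"
    using assms r_bound_le_one[OF l m] by unfold_locales auto
  show ?thesis by (rule rho_delta)
qed

text \<open>Since \<open>rho\<close> is monotone and inverts \<open>delta\<close> at irrationals,
  the order is read off the rotation numbers, without any computation with the series.\<close>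

lemma delta_strict_mono_irrational:
  assumes "0 < r" "r < r'" "r' < r_bound l m" "r \<notin> \<rat>" "r' \<notin> \<rat>"
  shows "delta l m r < delta l m r'"
proof (rule ccontr)
  assume "\<not> ?thesis"
  then have "rho l m (delta l m r') \<le> rho l m (delta l m r)"
    using l m delta_bounds assms by (intro rho_mono) auto
  then show False using assms by (simp add: rho_delta_irrational)
qed

text \<open>A strict bound on a one-sided limit holds at nearby irrationals, whose rotation numbers
  are known. This and the next three lemmas cover both sides and both directions of the
  bound.\<close>

lemma irrational_near_left:
  assumes "0 < r0" "r0 < r_bound l m" "c < left_limit r0" "a < r0"
  obtains r where "0 < r" "a < r" "r < r0" "r \<notin> \<rat>" "c < delta l m r"
proof -
  obtain b where b: "b < r0" "\<And>y. b < y \<Longrightarrow> y < r0 \<Longrightarrow> c < delta l m y"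
    using order_tendstoD(1)[OF tendsto_left[OF assms(1,2)] assms(3)]
    unfolding eventually_at_left_field by blast
  have "max 0 (max a b) < r0" using assms b by simp
  then obtain r where "max 0 (max a b) < r" "r < r0" "r \<notin> \<rat>" using irrational_between by blast
  then show ?thesis using b by (intro that[of r]) auto
qed

lemma irrational_below_left:
  assumes "0 < r0" "r0 < r_bound l m" "left_limit r0 < c" "a < r0"
  obtains r where "0 < r" "a < r" "r < r0" "r \<notin> \<rat>" "delta l m r < c"
proof -
  obtain b where b: "b < r0" "\<And>y. b < y \<Longrightarrow> y < r0 \<Longrightarrow> delta l m y < c"
    using order_tendstoD(2)[OF tendsto_left[OF assms(1,2)] assms(3)]
    unfolding eventually_at_left_field by blast
  have "max 0 (max a b) < r0" using assms b by simp
  then obtain r where "max 0 (max a b) < r" "r < r0" "r \<notin> \<rat>" using irrational_between by blast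
  then show ?thesis using b by (intro that[of r]) auto
qed

lemma irrational_near_right:
  assumes "0 < r0" "r0 < r_bound l m" "delta l m r0 < c" "r0 < a"
  obtains r where "r0 < r" "r < a" "r < r_bound l m" "r \<notin> \<rat>" "delta l m r < c"
proof -
  obtain b where b: "r0 < b" "\<And>y. r0 < y \<Longrightarrow> y < b \<Longrightarrow> delta l m y < c"
    using order_tendstoD(2)[OF tendsto_right[OF assms(1,2)] assms(3)]
    unfolding eventually_at_right_field by blast
  have "r0 < min (r_bound l m) (min a b)" using assms b by simp
  then obtain r where "r0 < r" "r < min (r_bound l m) (min a b)" "r \<notin> \<rat>"
    using irrational_between by blast
  then show ?thesis using b by (intro that[of r]) auto
qed

lemma irrational_above_right:
  assumes "0 < r0" "r0 < r_bound l m" "c < delta l m r0" "r0 < a"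
  obtains r where "r0 < r" "r < a" "r < r_bound l m" "r \<notin> \<rat>" "c < delta l m r"
proof -
  obtain b where b: "r0 < b" "\<And>y. r0 < y \<Longrightarrow> y < b \<Longrightarrow> c < delta l m y"
    using order_tendstoD(1)[OF tendsto_right[OF assms(1,2)] assms(3)]
    unfolding eventually_at_right_field by blast
  have "r0 < min (r_bound l m) (min a b)" using assms b by simp
  then obtain r where "r0 < r" "r < min (r_bound l m) (min a b)" "r \<notin> \<rat>"
    using irrational_between by blast
  then show ?thesis using b by (intro that[of r]) auto
qed

lemma delta_le_left_limit:
  assumes "0 < r" "r < r0" "r0 < r_bound l m" "r \<notin> \<rat>"
  shows "delta l m r \<le> left_limit r0"
proof (rule ccontr)
  assume "\<not> ?thesis"
  then obtain r' where "r < r'" "r' < r0" "r' \<notin> \<rat>" "delta l m r' < delta l m r"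
    using irrational_below_left[of r0 "delta l m r" r] assms by force
  then show False using delta_strict_mono_irrational[of r r'] assms by simp
qed

lemma delta_le_delta_right:
  assumes "0 < r0" "r0 < r" "r < r_bound l m" "r \<notin> \<rat>"
  shows "delta l m r0 \<le> delta l m r"
proof (rule ccontr)
  assume "\<not> ?thesis"
  then obtain r' where "r0 < r'" "r' < r" "r' \<notin> \<rat>" "delta l m r < delta l m r'"
    using irrational_above_right[of r0 "delta l m r" r] assms by force
  then show False using delta_strict_mono_irrational[of r' r] assms by simp
qed

text \<open>A value strictly between the two limits in the wrong order would separate irrationals on
  either side of \<open>r0\<close> against strict monotonicity. The level interval is thus nonempty,
  which gives surjectivity.\<close>

lemma left_limit_le_delta:
  assumes "0 < r0" "r0 < r_bound l m" shows "left_limit r0 \<le> delta l m r0"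
proof (rule ccontr)
  assume "\<not> ?thesis"
  then have "delta l m r0 < left_limit r0" by simp
  then obtain c where c: "delta l m r0 < c" "c < left_limit r0" using dense by blast
  obtain r where r: "0 < r" "r < r0" "r \<notin> \<rat>" "c < delta l m r"
    using irrational_near_left[OF assms c(2), of 0] assms by blast
  obtain r' where r': "r0 < r'" "r' < r_bound l m" "r' \<notin> \<rat>" "delta l m r' < c"
    using irrational_near_right[OF assms c(1), of "r_bound l m"] assms by blast
  show False using delta_strict_mono_irrational[of r r'] r r' by simp
qed

text \<open>A parameter outside the interval is separated from it by some \<open>delta l m r\<close>
  with \<open>r\<close> irrational, which keeps its rotation number away from \<open>r0\<close>.
  Conversely, a rotation number other than \<open>r0\<close> leaves an irrational in between, whose
  parameter lies on the wrong side of \<open>\<delta>\<close>.\<close>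

lemma rho_eq_iff:
  assumes r0: "0 < r0" "r0 < r_bound l m" and \<delta>: "1 - l < \<delta>" "\<delta> < d_bound l m"
  shows "rho l m \<delta> = r0 \<longleftrightarrow> left_limit r0 \<le> \<delta> \<and> \<delta> \<le> delta l m r0"
proof (intro iffI conjI)
  assume eq: "rho l m \<delta> = r0"
  show "left_limit r0 \<le> \<delta>"
  proof (rule ccontr)
    assume "\<not> ?thesis"
    then obtain r where r: "0 < r" "r < r0" "r \<notin> \<rat>" "\<delta> < delta l m r"
      using irrational_near_left[OF r0, of \<delta> 0] r0 by force
    then have "rho l m \<delta> \<le> rho l m (delta l m r)"
      using l m \<delta> r0 delta_bounds[of r] by (intro rho_mono) auto
    then show False using eq r r0 by (simp add: rho_delta_irrational)
  qed
  show "\<delta> \<le> delta l m r0"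
  proof (rule ccontr)
    assume "\<not> ?thesis"
    then obtain r where r: "r0 < r" "r < r_bound l m" "r \<notin> \<rat>" "delta l m r < \<delta>"
      using irrational_near_right[OF r0, of \<delta> "r_bound l m"] r0 by force
    then have "rho l m (delta l m r) \<le> rho l m \<delta>"
      using l m \<delta> r0 delta_bounds[of r] by (intro rho_mono) auto
    then show False using eq r r0 by (simp add: rho_delta_irrational)
  qed
next
  assume in_range: "left_limit r0 \<le> \<delta> \<and> \<delta> \<le> delta l m r0"
  show "rho l m \<delta> = r0"
  proof (rule antisym)
    show "rho l m \<delta> \<le> r0"
    proof (rule ccontr)
      assume "\<not> ?thesis"
      \<comment> \<open>The minimum keeps the irrational inside the domain of \<open>delta\<close>,
        as the bound on \<open>rho\<close> is only proved later.\<close>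
      then have "r0 < min (rho l m \<delta>) (r_bound l m)" using r0 by simp
      then obtain r where r: "r0 < r" "r < min (rho l m \<delta>) (r_bound l m)" "r \<notin> \<rat>"
        using irrational_between by blast
      then have "\<delta> \<le> delta l m r" using delta_le_delta_right[of r0 r] r0 in_range by auto
      then have "rho l m \<delta> \<le> rho l m (delta l m r)"
        using l m \<delta> r0 r delta_bounds[of r] by (intro rho_mono) auto
      then show False using r r0 by (simp add: rho_delta_irrational)
    qed
    show "r0 \<le> rho l m \<delta>"
    proof (rule ccontr)
      assume "\<not> ?thesis"
      then have "max 0 (rho l m \<delta>) < r0" using r0 by simp
      then obtain r where r: "max 0 (rho l m \<delta>) < r" "r < r0" "r \<notin> \<rat>"
        using irrational_between by blast
      then have "delta l m r \<le> \<delta>" using delta_le_left_limit[of r r0] r0 in_range by auto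
      then have "rho l m (delta l m r) \<le> rho l m \<delta>"
        using l m \<delta> r0 r delta_bounds[of r] by (intro rho_mono) auto
      then show False using r r0 by (simp add: rho_delta_irrational)
    qed
  qed
qed

lemma left_limit_irrational:
  assumes "r \<notin> \<rat>" "0 < r" "r < r_bound l m" shows "left_limit r = delta l m r"
proof -
  have "\<lceil>real (Suc n) * r\<rceil> - 1 = \<lfloor>real (Suc n) * r\<rfloor>" for n
  proof -
    have "real (Suc n) * r \<notin> \<int>"
    proof
      assume "real (Suc n) * r \<in> \<int>"
      then have "real (Suc n) * r / of_nat (Suc n) \<in> \<rat>"
        by (intro Rats_divide Rats_of_nat) (use Ints_subset_Rats in blast)
      then show False using assms by simp
    qed
    then have "real (Suc n) * r \<noteq> of_int \<lfloor>real (Suc n) * r\<rfloor>" by (metis Ints_of_int)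
    then show ?thesis unfolding ceiling_altdef by simp
  qed
  then have "(\<lambda>n. \<lceil>real (Suc n) * r\<rceil> - 1) = (\<lambda>n. \<lfloor>real (Suc n) * r\<rfloor>)" by blast
  then show ?thesis
    by (simp only: left_limit_def delta_eq_D[OF exponents_floor[OF l m assms(2) order_refl assms(3)]])
qed

text \<open>For \<open>l * m \<ge> 1\<close>, letting \<open>r\<close> approach
  \<open>r_bound\<close> drives \<open>l * m powr r\<close> to 1 and \<open>T\<close> to infinity,
  so the gap \<open>1 / T\<close> of \<open>delta l m r\<close> falls below the gap \<open>g\<close>
  of \<open>\<delta>\<close>. For \<open>m > 1\<close> a smaller gap means a larger parameter, and
  monotonicity gives \<open>rho l m \<delta> \<le> r\<close>.\<close>

lemma rho_less_r_bound:
  assumes "1 - l < \<delta>" "\<delta> < d_bound l m" shows "rho l m \<delta> < r_bound l m"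
proof (cases "l * m < 1")
  case True
  then show ?thesis using rho_less_one[OF l m assms] by (simp add: r_bound_def)
next
  case False
  then have m1: "m > 1" using l by (intro one_less_of_one_le_mult)
  define R where "R = r_bound l m"
  define g where "g = \<delta> - m * (l + \<delta> - 1)"
  have g: "g > 0" using d_bound_imp[OF l m assms] by (simp add: g_def)
  have R: "R = - ln l / ln m" using False by (simp add: R_def r_bound_def)
  then have R0: "0 < R" using l m1 by (simp add: divide_neg_pos)
  have "m powr R = exp (- ln l)" using m1 by (simp add: R powr_def)
  then have "l * m powr R = 1" using l by (simp add: exp_minus)
  moreover have "((\<lambda>r. l * m powr r) \<longlongrightarrow> l * m powr R) (at_left R)"
    using m1 by (intro tendsto_intros) auto
  ultimately have "\<forall>\<^sub>F r in at_left R. 1 - g / m < l * m powr r"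
    using g m by (intro order_tendstoD(1)) auto
  then obtain b where b: "b < R" "\<And>r. b < r \<Longrightarrow> r < R \<Longrightarrow> 1 - g / m < l * m powr r"
    unfolding eventually_at_left_field by blast
  have "max 0 b < R" using b R0 by simp
  then obtain r where "max 0 b < r" "r < R" "r \<notin> \<rat>" using irrational_between by blast
  then have r_range: "0 < r" "r < r_bound l m" "r \<notin> \<rat>" "1 - g / m < l * m powr r"
    using b by (auto simp: R_def)
  interpret exponents l m r "\<lambda>n. \<lfloor>real (Suc n) * r\<rfloor>"
    using l m r_range by (intro exponents_floor) auto
  define x where "x = l * m powr r"
  have x: "0 < x" "x < 1" using l m lm by (auto simp: x_def)
  \<comment> \<open>The exponent in \<open>w n\<close> is at least \<open>n * r - 1\<close>, so
    \<open>T\<close> is at least a geometric sum; \<open>r\<close> was chosen with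
    \<open>m * (1 - x) < g\<close>.\<close>
  have "x ^ n * (1 / m) \<le> w n" for n
  proof -
    have "x ^ n * (1 / m) = l ^ n * m powr (real n * r - 1)"
      using m by (simp add: x_def power_mult_distrib powr_diff powr_powr mult.commute flip: powr_realpow)
    also have "m powr (real n * r - 1) \<le> m powr of_int \<lfloor>real (Suc n) * r\<rfloor>"
    proof (rule powr_mono)
      have "real (Suc n) * r = real n * r + r" by (simp add: algebra_simps)
      then show "real n * r - 1 \<le> of_int \<lfloor>real (Suc n) * r\<rfloor>" using r by linarith
    qed (use m1 in simp)
    also have "m powr of_int \<lfloor>real (Suc n) * r\<rfloor> = m powi \<lfloor>real (Suc n) * r\<rfloor>"
      using m by (simp add: powr_real_of_int')
    finally show ?thesis using l by (simp only: w_def) simp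
  qed
  then have "(\<Sum>n. x ^ n * (1 / m)) \<le> T"
    unfolding T_def using x by (intro suminf_le summable_mult2 summable_w) auto
  moreover have "(\<Sum>n. x ^ n * (1 / m)) = 1 / (m * (1 - x))"
    using x suminf_mult2[of "\<lambda>n. x ^ n" "1 / m"] by (simp add: suminf_geometric mult.commute)
  ultimately have "1 / (m * (1 - x)) \<le> T" by simp
  then have "1 / T \<le> 1 / (1 / (m * (1 - x)))" using x m T_pos by (intro divide_left_mono) auto
  then have "1 / T \<le> m * (1 - x)" by simp
  also have "m * (1 - x) < m * (g / m)"
  proof (rule mult_strict_left_mono[OF _ m])
    show "1 - x < g / m" unfolding x_def using r_range(4) by linarith
  qed
  also have "\<dots> = g" using m by simp
  finally have "D - m * (l + D - 1) < \<delta> - m * (l + \<delta> - 1)"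
    by (simp only: gap_eq g_def)
  then have "(m - 1) * \<delta> < (m - 1) * D" by (simp add: algebra_simps)
  then have "\<delta> < D" using m1 by simp
  then have "\<delta> < delta l m r" by (simp only: delta_eq_D[OF exponents_axioms])
  then have "rho l m \<delta> \<le> rho l m (delta l m r)"
    using l m assms r_range delta_bounds[of r] by (intro rho_mono) auto
  then show ?thesis using r_range by (simp add: rho_delta_irrational)
qed

lemma rho_image: "(\<lambda>\<delta>. rho l m \<delta>) ` {1 - l <..< d_bound l m} = {0 <..< r_bound l m}"
proof (intro equalityI subsetI)
  fix r assume "r \<in> {0 <..< r_bound l m}"
  then have r: "0 < r" "r < r_bound l m" by auto
  have "rho l m (delta l m r) = r"
    using rho_eq_iff[OF r delta_bounds[OF r]] left_limit_le_delta[OF r] by simp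
  then show "r \<in> (\<lambda>\<delta>. rho l m \<delta>) ` {1 - l <..< d_bound l m}"
    using delta_bounds[OF r] by force
qed (use l m rho_pos rho_less_r_bound in auto)

lemma rho_mono_on: "mono_on {1 - l <..< d_bound l m} (\<lambda>\<delta>. rho l m \<delta>)"
  using l m by (intro mono_onI rho_mono) auto

text \<open>A jump of a monotone function would leave a hole in its image, but the image is an open
  interval.\<close>

lemma continuous_on_rho: "continuous_on {1 - l <..< d_bound l m} (\<lambda>\<delta>. rho l m \<delta>)"
  by (rule continuous_onI_mono) (use rho_image l m in \<open>auto intro: rho_mono\<close>)

end

lemma (in exponents) D_of_quotient:
  assumes "s = a / c" "c \<noteq> 0" shows "D = (1 - l) * (c + m * a) / (c + (m - 1) * a)"
proof -
  have "1 + m * s = (c + m * a) / c" "1 + (m - 1) * s = (c + (m - 1) * a) / c"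
    using assms by (simp_all add: field_simps)
  then show ?thesis unfolding D_def using assms(2) by simp
qed

subsection \<open>Rational rotation numbers\<close>

locale rational_rotation = rotation_family +
  fixes p q :: nat
  assumes pq: "0 < p" "coprime p q" "real p / real q < r_bound l m"
    and q: "0 < q"
begin

lemma ratio_pos: "0 < real p / real q"
  using pq q by simp

lemma p_less_q: "p < q"
proof -
  have "real p / real q < 1" using pq r_bound_le_one[OF l m] by linarith
  then show ?thesis using q by simp
qed

lemma q_ge_2: "2 \<le> q"
  using p_less_q pq(1) by linarith

lemma period_contraction: "l ^ q * m ^ p < 1"
proof -
  have "l * m powr (real p / real q) < 1"
    using l m ratio_pos pq by (intro mult_powr_less_one)
  then have "(l * m powr (real p / real q)) ^ q < 1"
    using l m q by (intro power_less_one_iff[THEN iffD2] conjI) auto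
  moreover have "(m powr (real p / real q)) ^ q = m ^ p"
    using m q by (simp add: powr_powr powr_realpow flip: powr_realpow)
  ultimately show ?thesis by (simp add: power_mult_distrib)
qed

abbreviation up :: "nat \<Rightarrow> int" where "up n \<equiv> \<lfloor>real (Suc n) * (real p / real q)\<rfloor>"

abbreviation lo :: "nat \<Rightarrow> int" where "lo n \<equiv> \<lceil>real (Suc n) * (real p / real q)\<rceil> - 1"

lemma multiple_shift: "real (Suc (n + q)) * (real p / real q) = real (Suc n) * (real p / real q) + of_int (int p)"
  using q by (simp add: field_simps)

lemma up_periodic: "up (n + q) = up n + int p"
  unfolding multiple_shift by (rule floor_add_int[symmetric])

lemma lo_periodic: "lo (n + q) = lo n + int p"
  unfolding multiple_shift ceiling_add_of_int by simp

lemma multiple_not_int: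
  assumes "Suc n < q" shows "real (Suc n) * (real p / real q) \<noteq> of_int i"
proof
  assume "real (Suc n) * (real p / real q) = of_int i"
  then have "real_of_int (int (Suc n * p)) = of_int (i * int q)"
    using q by (simp add: field_simps)
  then have "int (Suc n * p) = i * int q" by (simp only: of_int_eq_iff)
  then have "int q dvd int (Suc n * p)" by simp
  then have "q dvd Suc n * p" by (simp only: int_dvd_int_iff)
  then have "q dvd Suc n" using pq(2) by (metis coprime_commute coprime_dvd_mult_left_iff)
  then show False using assms by (auto dest: dvd_imp_le)
qed

lemma lo_eq_up: assumes "Suc n < q" shows "lo n = up n"
  using multiple_not_int[OF assms, of "up n"] by (simp add: ceiling_altdef)

lemma exponents_up: "exponents l m (real p / real q) up"
  using l m ratio_pos order_refl pq(3) by (rule exponents_floor)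

lemma exponents_lo: "exponents l m (real p / real q) lo"
  using l m ratio_pos pq(3) by (rule exponents_ceiling)

text \<open>These indices belong to the multiples \<open>q - 1\<close>, \<open>q\<close> and
  \<open>q + 1\<close>. The last jump of the period occurs from \<open>j\<close> to
  \<open>Suc j\<close> for \<open>up\<close>, but one index later for \<open>lo\<close>; this is the
  only difference between the two formulae.\<close>

lemma last_values:
  assumes "q = Suc (Suc j)"
  shows "up j = int p - 1" "up (Suc j) = int p" "lo (Suc j) = int p - 1"
    "up (Suc (Suc j)) = int p" "lo (Suc (Suc j)) = int p"
proof -
  define x where "x = real p / real q"
  have x: "0 < x" "x < 1" using ratio_pos p_less_q by (simp_all add: x_def)
  have "real (Suc (Suc j)) * x = real p" using q assms by (simp add: x_def)
  moreover from this have "real (Suc j) * x = real p - x" "real (Suc (Suc (Suc j))) * x = real p + x"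
    by (simp_all add: algebra_simps)
  ultimately show "up j = int p - 1" "up (Suc j) = int p" "lo (Suc j) = int p - 1"
    "up (Suc (Suc j)) = int p" "lo (Suc (Suc j)) = int p"
    using x unfolding x_def[symmetric] by (simp_all only:) linarith+
qed

lemma S_sum_eq:
  assumes "q = Suc (Suc j)"
  shows "S_sum l m p q = (\<Sum>n<j. of_int (up (Suc n) - up n) * l ^ Suc n * m powi up n)"
proof -
  have "q - 2 = j" using assms by simp
  then show ?thesis
    unfolding S_sum_def by (simp only: One_nat_def sum.atLeast1_atMost_eq) simp
qed

lemma delta_rational:
  "delta l m (real p / real q) =
     (1 - l) * (1 + m * S_sum l m p q + l ^ (q - 1) * m ^ p * (1 - l))
     / (1 + (m - 1) * S_sum l m p q + l ^ (q - 1) * m ^ (p - 1) * (m - l * m - 1))"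
proof -
  interpret exponents l m "real p / real q" up by (rule exponents_up)
  obtain j where j: "q = Suc (Suc j)" using le_Suc_ex[OF q_ge_2] by auto
  obtain i where i: "p = Suc i" using pq(1) gr0_conv_Suc by blast
  \<comment> \<open>The sum over one period: the jump at \<open>n = j\<close> adds
    \<open>l ^ (q - 1) * m ^ (p - 1)\<close>, and the term \<open>n = Suc j\<close>
    vanishes.\<close>
  define A where "A = S_sum l m p q + l ^ Suc j * m ^ i"
  have "s = A / (1 - l ^ q * m ^ p)"
    unfolding s_periodic[OF up_periodic q period_contraction]
  proof (rule arg_cong[where f = "\<lambda>t. t / (1 - l ^ q * m ^ p)"])
    have "(\<Sum>n<q. of_int (up (Suc n) - up n) * l ^ Suc n * m powi up n)
        = S_sum l m p q + of_int (up (Suc j) - up j) * l ^ Suc j * m powi up j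
          + of_int (up (Suc (Suc j)) - up (Suc j)) * l ^ Suc (Suc j) * m powi up (Suc j)"
      unfolding S_sum_eq[OF j] by (subst j) (simp only: sum.lessThan_Suc)
    also have "\<dots> = A"
      unfolding last_values[OF j] by (simp add: A_def i)
    finally show "(\<Sum>n<q. of_int (up (Suc n) - up n) * l ^ Suc n * m powi up n) = A" .
  qed
  then have "D = (1 - l) * (1 - l ^ q * m ^ p + m * A) / (1 - l ^ q * m ^ p + (m - 1) * A)"
    using period_contraction by (intro D_of_quotient) auto
  moreover have "1 - l ^ q * m ^ p + m * A = 1 + m * S_sum l m p q + l ^ (q - 1) * m ^ p * (1 - l)"
    "1 - l ^ q * m ^ p + (m - 1) * A
      = 1 + (m - 1) * S_sum l m p q + l ^ (q - 1) * m ^ (p - 1) * (m - l * m - 1)"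
    unfolding A_def i j by (simp_all add: algebra_simps)
  ultimately show ?thesis
    by (simp only: delta_eq_D[OF exponents_up])
qed

lemma left_limit_rational:
  "left_limit (real p / real q) =
     (1 - l) * (1 + m * S_sum l m p q) / (1 + (m - 1) * S_sum l m p q - l ^ q * m ^ (p - 1))"
proof -
  interpret exponents l m "real p / real q" lo by (rule exponents_lo)
  obtain j where j: "q = Suc (Suc j)" using le_Suc_ex[OF q_ge_2] by auto
  obtain i where i: "p = Suc i" using pq(1) gr0_conv_Suc by blast
  \<comment> \<open>The jump now sits at \<open>n = Suc j\<close>, hence the extra factor
    \<open>l\<close>. In the numerator \<open>m * A\<close> then cancels
    \<open>l ^ q * m ^ p\<close>.\<close>
  define A where "A = S_sum l m p q + l ^ q * m ^ i"
  have lo: "lo n = up n" if "n \<le> j" for n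
    using that j by (intro lo_eq_up) simp
  have "s = A / (1 - l ^ q * m ^ p)"
    unfolding s_periodic[OF lo_periodic q period_contraction]
  proof (rule arg_cong[where f = "\<lambda>t. t / (1 - l ^ q * m ^ p)"])
    have "(\<Sum>n<q. of_int (lo (Suc n) - lo n) * l ^ Suc n * m powi lo n)
        = (\<Sum>n<j. of_int (lo (Suc n) - lo n) * l ^ Suc n * m powi lo n)
          + of_int (lo (Suc j) - lo j) * l ^ Suc j * m powi lo j
          + of_int (lo (Suc (Suc j)) - lo (Suc j)) * l ^ Suc (Suc j) * m powi lo (Suc j)"
      by (subst j) (simp only: sum.lessThan_Suc)
    also have "(\<Sum>n<j. of_int (lo (Suc n) - lo n) * l ^ Suc n * m powi lo n) = S_sum l m p q"
      unfolding S_sum_eq[OF j]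
    proof (rule sum.cong[OF refl])
      fix n assume "n \<in> {..<j}"
      then have "n \<le> j" "Suc n \<le> j" by auto
      from lo[OF this(1)] lo[OF this(2)] show "of_int (lo (Suc n) - lo n) * l ^ Suc n * m powi lo n
          = of_int (up (Suc n) - up n) * l ^ Suc n * m powi up n" by (simp only:)
    qed
    also have "S_sum l m p q + of_int (lo (Suc j) - lo j) * l ^ Suc j * m powi lo j
          + of_int (lo (Suc (Suc j)) - lo (Suc j)) * l ^ Suc (Suc j) * m powi lo (Suc j) = A"
      unfolding lo[OF order_refl] last_values[OF j] by (simp add: A_def i j)
    finally show "(\<Sum>n<q. of_int (lo (Suc n) - lo n) * l ^ Suc n * m powi lo n) = A" .
  qed
  then have "D = (1 - l) * (1 - l ^ q * m ^ p + m * A) / (1 - l ^ q * m ^ p + (m - 1) * A)"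
    using period_contraction by (intro D_of_quotient) auto
  moreover have "1 - l ^ q * m ^ p + m * A = 1 + m * S_sum l m p q"
    "1 - l ^ q * m ^ p + (m - 1) * A = 1 + (m - 1) * S_sum l m p q - l ^ q * m ^ (p - 1)"
    unfolding A_def i by (simp_all add: algebra_simps)
  ultimately show ?thesis
    by (simp only: left_limit_def)
qed

end

theorem theorem1:
  fixes l m :: real
  assumes "0 < l" and "l < 1" and "m > 0"
  shows "continuous_on {1 - l <..< d_bound l m} (\<lambda>\<delta>. rho l m \<delta>)
    \<and> mono_on {1 - l <..< d_bound l m} (\<lambda>\<delta>. rho l m \<delta>)
    \<and> (\<lambda>\<delta>. rho l m \<delta>) ` {1 - l <..< d_bound l m} = {0 <..< r_bound l m}
    \<and> (\<forall>(p::nat) (q::nat).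
         p > 0 \<and> q > 0 \<and> coprime p q \<and> real p / real q < r_bound l m \<longrightarrow>
           (\<forall>\<delta> \<in> {1 - l <..< d_bound l m}.
              rho l m \<delta> = real p / real q \<longleftrightarrow>
                delta_left l m (real p / real q) \<le> \<delta> \<and> \<delta> \<le> delta l m (real p / real q))
         \<and> delta l m (real p / real q) =
             (1 - l) * (1 + m * S_sum l m p q + l ^ (q - 1) * m ^ p * (1 - l))
             / (1 + (m - 1) * S_sum l m p q + l ^ (q - 1) * m ^ (p - 1) * (m - l * m - 1))
         \<and> ((\<lambda>r. delta l m r) \<longlongrightarrow> delta_left l m (real p / real q))
             (at_left (real p / real q))
         \<and> delta_left l m (real p / real q) =
             (1 - l) * (1 + m * S_sum l m p q)
             / (1 + (m - 1) * S_sum l m p q - l ^ q * m ^ (p - 1))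
         \<and> (q = 2 \<longrightarrow> S_sum l m p q = 0))
    \<and> (\<forall>r::real. r \<notin> \<rat> \<and> 0 < r \<and> r < r_bound l m \<longrightarrow>
         (\<exists>!\<delta>. 1 - l < \<delta> \<and> \<delta> < d_bound l m \<and> rho l m \<delta> = r)
         \<and> 1 - l < delta l m r \<and> delta l m r < d_bound l m \<and> rho l m (delta l m r) = r)"
proof -
  interpret rotation_family l m using assms by unfold_locales
  have rational: "(\<forall>\<delta> \<in> {1 - l <..< d_bound l m}.
              rho l m \<delta> = real p / real q \<longleftrightarrow>
                delta_left l m (real p / real q) \<le> \<delta> \<and> \<delta> \<le> delta l m (real p / real q))
         \<and> delta l m (real p / real q) =
             (1 - l) * (1 + m * S_sum l m p q + l ^ (q - 1) * m ^ p * (1 - l))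
             / (1 + (m - 1) * S_sum l m p q + l ^ (q - 1) * m ^ (p - 1) * (m - l * m - 1))
         \<and> ((\<lambda>r. delta l m r) \<longlongrightarrow> delta_left l m (real p / real q))
             (at_left (real p / real q))
         \<and> delta_left l m (real p / real q) =
             (1 - l) * (1 + m * S_sum l m p q)
             / (1 + (m - 1) * S_sum l m p q - l ^ q * m ^ (p - 1))
         \<and> (q = 2 \<longrightarrow> S_sum l m p q = 0)"
    if "p > 0 \<and> q > 0 \<and> coprime p q \<and> real p / real q < r_bound l m" for p q
  proof -
    interpret rational_rotation l m p q using that by unfold_locales auto
    note r = ratio_pos pq(3)
    show ?thesis
      unfolding delta_left_eq[OF r]
      by (intro conjI ballI delta_rational left_limit_rational tendsto_left r rho_eq_iff)
        (auto simp: S_sum_def)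
  qed
  have irrational: "(\<exists>!\<delta>. 1 - l < \<delta> \<and> \<delta> < d_bound l m \<and> rho l m \<delta> = r)
         \<and> 1 - l < delta l m r \<and> delta l m r < d_bound l m \<and> rho l m (delta l m r) = r"
    if r: "r \<notin> \<rat> \<and> 0 < r \<and> r < r_bound l m" for r
  proof -
    \<comment> \<open>At an irrational the two ends of the level interval coincide.\<close>
    have "\<delta> = delta l m r" if "1 - l < \<delta>" "\<delta> < d_bound l m" "rho l m \<delta> = r" for \<delta>
      using rho_eq_iff[of r \<delta>] left_limit_irrational[of r] r that by auto
    moreover have "1 - l < delta l m r" "delta l m r < d_bound l m" "rho l m (delta l m r) = r"
      using r delta_bounds rho_delta_irrational by auto
    ultimately show ?thesis by blast
  qed
  show ?thesis
    using continuous_on_rho rho_mono_on rho_image rational irrational by blast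
qed

end
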